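(* Let $B$ be a good skew brace having property (S). Then the following conditions are equivalent: (1) $B$ is locally annihilator-nilpotent; (2) $B=\overline{\operatorname{Ann}}(B)$.
   Context: A skew (left) brace is a triple $(B,+,\circ)$ where $(B,+)$ and $(B,\circ)$ are (not necessarily abelian) groups such that $a\circ(b+c)=a\circ b-a+a\circ c$ for all $a,b,c\in B$. The two identities coincide and are denoted $0$. Put $\lambda_a(b)=-a+a\circ b$ and $a\ast b=\lambda_a(b)-b=-a+a\circ b-b$; $\lambda:(B,\circ)\to\operatorname{Aut}(B,+)$, $a\mapsto\lambda_a$, is a group homomorphism. For $x\in B$ let $\operatorname{Fix}^r(x)=\{b\in B: x\ast b=0\}$ (a subgroup of $(B,+)$), $\operatorname{Fix}^l(x)=\{b\in B: b\ast x=0\}$ (a subgroup of $(B,\circ)$), and let $C_x^+$, $C_x^\circ$ be the centralisers of $x$ in $(B,+)$ and $(B,\circ)$. An element $x$ has property (s) if the indices $|(B,+):\operatorname{Fix}^r(x)\cap C_x^+|$ and $|(B,\circ):\operatorname{Fix}^l(x)\cap C_x^\circ|$ are both finite. $B$ has property (S) if all its elements have property (s). An ideal of $B$ is a subset $I$ that is a normal subgroup of both $(B,+)$ and $(B,\circ)$ and satisfies $\lambda_a(I)\subseteq I$ for all $a\in B$; then $B/I$ is a skew brace. A sub-skew brace is a subset that is a subgroup of both $(B,+)$ and $(B,\circ)$. A skew brace is finitely generated if it is the smallest sub-skew brace of itself containing some finite subset. An ideal of $B$ is finitely generated (as an ideal) if it is the smallest ideal of $B$ containing some finite subset. An ideal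 $I$ of a skew brace $B$ with property (S) is good if every finitely generated ideal $J$ of $B$ with $J\subseteq I$ is finitely generated as a skew brace; $B$ is good if it is a good ideal of itself. The annihilator is the ideal $\operatorname{Ann}(B)=\operatorname{Ker}(\lambda)\cap Z(B,+)\cap Z(B,\circ)$. The upper annihilator series is defined by $\operatorname{Ann}_0(B)=\{0\}$, $\operatorname{Ann}_{\alpha+1}(B)/\operatorname{Ann}_\alpha(B)=\operatorname{Ann}(B/\operatorname{Ann}_\alpha(B))$ for every ordinal $\alpha$, and $\operatorname{Ann}_\mu(B)=\bigcup_{\gamma<\mu}\operatorname{Ann}_\gamma(B)$ for limit ordinals $\mu$; its last term (where it stabilises) is the hyper-annihilator $\overline{\operatorname{Ann}}(B)$. A skew brace $B$ is annihilator nilpotent if $B=\operatorname{Ann}_n(B)$ for some non-negative integer $n$, and locally annihilator-nilpotent if every finitely generated sub-skew brace is annihilator nilpotent. *)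

theory Defs
  imports "HOL-Algebra.QuotRing" "HOL.Hull"
begin

text \<open>
  A skew brace is carried by a ring record: \<open>\<oplus>\<close> is the (possibly non-commutative) group
  operation \<open>+\<close>, i.e. \<open>(B,+)\<close> is \<^term>\<open>add_monoid B\<close>, and \<open>\<otimes>\<close> is the operation \<open>\<circ>\<close>,
  i.e. \<open>(B,\<circ>)\<close> is \<open>B\<close> seen as a monoid record.
\<close>

locale skew_brace =
  fixes B :: "('a, 'm) ring_scheme" (structure)
  assumes add_group: "group (add_monoid B)"
    and mult_group: "group B"
    and brace_distrib: "\<And>a b c. \<lbrakk>a \<in> carrier B; b \<in> carrier B; c \<in> carrier B\<rbrakk> \<Longrightarrow>
      a \<otimes> (b \<oplus> c) = (a \<otimes> b) \<ominus> a \<oplus> (a \<otimes> c)"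

definition brace_lambda :: "('a, 'm) ring_scheme \<Rightarrow> 'a \<Rightarrow> 'a \<Rightarrow> 'a" where
  "brace_lambda B a b = \<ominus>\<^bsub>B\<^esub> a \<oplus>\<^bsub>B\<^esub> (a \<otimes>\<^bsub>B\<^esub> b)"

definition brace_star :: "('a, 'm) ring_scheme \<Rightarrow> 'a \<Rightarrow> 'a \<Rightarrow> 'a" where
  "brace_star B a b = brace_lambda B a b \<ominus>\<^bsub>B\<^esub> b"

definition Fix_r :: "('a, 'm) ring_scheme \<Rightarrow> 'a \<Rightarrow> 'a set" where
  "Fix_r B x = {b \<in> carrier B. brace_star B x b = \<zero>\<^bsub>B\<^esub>}"

definition Fix_l :: "('a, 'm) ring_scheme \<Rightarrow> 'a \<Rightarrow> 'a set" where
  "Fix_l B x = {b \<in> carrier B. brace_star B b x = \<zero>\<^bsub>B\<^esub>}"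

definition centralizer :: "('a, 'm) monoid_scheme \<Rightarrow> 'a \<Rightarrow> 'a set" where
  "centralizer G x = {y \<in> carrier G. y \<otimes>\<^bsub>G\<^esub> x = x \<otimes>\<^bsub>G\<^esub> y}"

definition center :: "('a, 'm) monoid_scheme \<Rightarrow> 'a set" where
  "center G = {z \<in> carrier G. \<forall>x\<in>carrier G. z \<otimes>\<^bsub>G\<^esub> x = x \<otimes>\<^bsub>G\<^esub> z}"

definition element_property_s :: "('a, 'm) ring_scheme \<Rightarrow> 'a \<Rightarrow> bool" where
  "element_property_s B x \<longleftrightarrow>
     finite (rcosets\<^bsub>add_monoid B\<^esub> (Fix_r B x \<inter> centralizer (add_monoid B) x)) \<and>
     finite (rcosets\<^bsub>B\<^esub> (Fix_l B x \<inter> centralizer B x))"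

definition property_S :: "('a, 'm) ring_scheme \<Rightarrow> bool" where
  "property_S B \<longleftrightarrow> (\<forall>x\<in>carrier B. element_property_s B x)"

definition brace_ideal :: "('a, 'm) ring_scheme \<Rightarrow> 'a set \<Rightarrow> bool" where
  "brace_ideal B I \<longleftrightarrow> I \<lhd> add_monoid B \<and> I \<lhd> B \<and>
     (\<forall>a\<in>carrier B. brace_lambda B a ` I \<subseteq> I)"

definition sub_skew_brace :: "('a, 'm) ring_scheme \<Rightarrow> 'a set \<Rightarrow> bool" where
  "sub_skew_brace B C \<longleftrightarrow> subgroup C (add_monoid B) \<and> subgroup C B"

definition fg_brace :: "('a, 'm) ring_scheme \<Rightarrow> bool" where
  "fg_brace B \<longleftrightarrow>
     (\<exists>X. finite X \<and> X \<subseteq> carrier B \<and> carrier B = sub_skew_brace B hull X)"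

definition fg_ideal :: "('a, 'm) ring_scheme \<Rightarrow> 'a set \<Rightarrow> bool" where
  "fg_ideal B J \<longleftrightarrow> brace_ideal B J \<and>
     (\<exists>X. finite X \<and> X \<subseteq> carrier B \<and> J = brace_ideal B hull X)"

text \<open>The notion of a good ideal is only used for skew braces with \<^const>\<open>property_S\<close>.\<close>

definition good_ideal :: "('a, 'm) ring_scheme \<Rightarrow> 'a set \<Rightarrow> bool" where
  "good_ideal B I \<longleftrightarrow> brace_ideal B I \<and>
     (\<forall>J. fg_ideal B J \<and> J \<subseteq> I \<longrightarrow> fg_brace (B\<lparr>carrier := J\<rparr>))"

definition good_brace :: "('a, 'm) ring_scheme \<Rightarrow> bool" where
  "good_brace B \<longleftrightarrow> good_ideal B (carrier B)"

definition Ann :: "('a, 'm) ring_scheme \<Rightarrow> 'a set" where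
  "Ann B = {a \<in> carrier B. \<forall>b\<in>carrier B. brace_lambda B a b = b}
           \<inter> center (add_monoid B) \<inter> center B"

text \<open>
  For an ideal \<open>I\<close> of a skew brace, \<^term>\<open>B Quot I\<close> is the quotient \<open>B/I\<close>: the operations of
  \<^const>\<open>FactRing\<close> are the induced operations on the cosets \<open>I + a = I \<circ> a\<close>.
  \<open>Ann_next B I\<close> is the preimage in \<open>B\<close> of \<open>Ann(B/I)\<close>.
\<close>

definition Ann_next :: "('a, 'm) ring_scheme \<Rightarrow> 'a set \<Rightarrow> 'a set" where
  "Ann_next B I = {a \<in> carrier B. I +>\<^bsub>B\<^esub> a \<in> Ann (B Quot I)}"

text \<open>
  Ordinals are represented as the elements of the field of a well-order \<open>r\<close>; the ordinal
  \<open>\<alpha>\<close> is the successor of \<open>\<beta>\<close> iff \<^term>\<open>underS r \<alpha> = under r \<beta>\<close>.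
\<close>

definition Ann_series :: "('a, 'm) ring_scheme \<Rightarrow> 'i rel \<Rightarrow> 'i \<Rightarrow> 'a set" where
  "Ann_series B r = wo_rel.worec r (\<lambda>A \<alpha>.
     if underS r \<alpha> = {} then {\<zero>\<^bsub>B\<^esub>}
     else if \<exists>\<beta>\<in>underS r \<alpha>. underS r \<alpha> = under r \<beta>
       then Ann_next B (A (THE \<beta>. \<beta> \<in> underS r \<alpha> \<and> underS r \<alpha> = under r \<beta>))
     else (\<Union>\<gamma>\<in>underS r \<alpha>. A \<gamma>))"

lemma Ann_series_unfold:
  assumes "Well_order r"
  shows "Ann_series B r \<alpha> =
     (if underS r \<alpha> = {} then {\<zero>\<^bsub>B\<^esub>}
      else if \<exists>\<beta>\<in>underS r \<alpha>. underS r \<alpha> = under r \<beta>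
        then Ann_next B (Ann_series B r (THE \<beta>. \<beta> \<in> underS r \<alpha> \<and> underS r \<alpha> = under r \<beta>))
      else (\<Union>\<gamma>\<in>underS r \<alpha>. Ann_series B r \<gamma>))"
proof -
  have wo: "wo_rel r" using assms by (simp add: wo_rel_def)
  note ANTISYM = wo_rel.ANTISYM[OF wo]
  have uniq: "\<beta> = \<gamma>" if "\<beta> \<in> underS r \<alpha>" "underS r \<alpha> = under r \<beta>"
    "\<gamma> \<in> underS r \<alpha>" "underS r \<alpha> = under r \<gamma>" for \<alpha> \<beta> \<gamma>
    using that ANTISYM unfolding under_def antisym_def by blast
  let ?H = "\<lambda>A \<alpha>. if underS r \<alpha> = {} then {\<zero>\<^bsub>B\<^esub>}
     else if \<exists>\<beta>\<in>underS r \<alpha>. underS r \<alpha> = under r \<beta>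
       then Ann_next B (A (THE \<beta>. \<beta> \<in> underS r \<alpha> \<and> underS r \<alpha> = under r \<beta>))
     else (\<Union>\<gamma>\<in>underS r \<alpha>. A \<gamma>)"
  have the_in: "(THE \<beta>. \<beta> \<in> underS r \<alpha> \<and> underS r \<alpha> = under r \<beta>) \<in> underS r \<alpha>"
    if "\<exists>\<beta>\<in>underS r \<alpha>. underS r \<alpha> = under r \<beta>" for \<alpha>
    using theI'[of "\<lambda>\<beta>. \<beta> \<in> underS r \<alpha> \<and> underS r \<alpha> = under r \<beta>"] that uniq by blast
  have "wo_rel.adm_wo r ?H"
    unfolding wo_rel.adm_wo_def[OF wo] using the_in by (auto split: if_splits)
  then show ?thesis
    unfolding Ann_series_def by (subst wo_rel.worec_fixpoint[OF wo]) auto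
qed

lemma Ann_series_zero:
  assumes "Well_order r" "underS r \<alpha> = {}"
  shows "Ann_series B r \<alpha> = {\<zero>\<^bsub>B\<^esub>}"
  using assms by (simp add: Ann_series_unfold)

lemma Ann_series_succ:
  assumes "Well_order r" "\<beta> \<in> underS r \<alpha>" "underS r \<alpha> = under r \<beta>"
  shows "Ann_series B r \<alpha> = Ann_next B (Ann_series B r \<beta>)"
proof -
  have wo: "wo_rel r" using assms by (simp add: wo_rel_def)
  note ANTISYM = wo_rel.ANTISYM[OF wo]
  have "(THE \<gamma>. \<gamma> \<in> underS r \<alpha> \<and> underS r \<alpha> = under r \<gamma>) = \<beta>"
    using assms(2,3) ANTISYM unfolding under_def antisym_def
    by (intro the_equality) blast+
  then show ?thesis
    using assms by (subst Ann_series_unfold) auto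
qed

lemma Ann_series_limit:
  assumes "Well_order r" "underS r \<alpha> \<noteq> {}"
    and "\<And>\<beta>. \<beta> \<in> underS r \<alpha> \<Longrightarrow> underS r \<alpha> \<noteq> under r \<beta>"
  shows "Ann_series B r \<alpha> = (\<Union>\<gamma>\<in>underS r \<alpha>. Ann_series B r \<gamma>)"
  using assms by (subst Ann_series_unfold) auto

text \<open>
  The last term of the upper annihilator series is the term at the least index from which on
  the series is constant.  The cardinal order of the type \<^typ>\<open>'a set\<close>, whose field is the
  whole type, is long enough for stabilisation: a strictly increasing chain of subsets of
  \<^typ>\<open>'a\<close> that starts with \<open>{0}\<close> is indexed by an ordinal of cardinality at most that of
  \<^typ>\<open>'a\<close>.
\<close>

definition hyper_Ann :: "('a, 'm) ring_scheme \<Rightarrow> 'a set" where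
  "hyper_Ann B =
     (let r = card_of (UNIV :: 'a set set)
      in Ann_series B r (wo_rel.minim r
           {\<alpha>. \<forall>\<beta>. (\<alpha>, \<beta>) \<in> r \<longrightarrow> Ann_series B r \<beta> = Ann_series B r \<alpha>}))"

definition ann_nilpotent :: "('a, 'm) ring_scheme \<Rightarrow> bool" where
  "ann_nilpotent B \<longleftrightarrow> (\<exists>n::nat. carrier B = Ann_series B natLeq n)"

definition locally_ann_nilpotent :: "('a, 'm) ring_scheme \<Rightarrow> bool" where
  "locally_ann_nilpotent B \<longleftrightarrow>
     (\<forall>C. sub_skew_brace B C \<and> fg_brace (B\<lparr>carrier := C\<rparr>) \<longrightarrow>
          ann_nilpotent (B\<lparr>carrier := C\<rparr>))"

end

theory Submission
  imports Defs "HOL-Algebra.Generated_Groups"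
begin

text \<open>
  The argument reduces statements about a skew brace with property (S) to finitely many
  elements by means of two facts.

  Generators: let \<open>C\<close> be a sub-skew brace generated by a finite set \<open>X\<close>.  Since
  \<open>Fix_l x\<close> has finite index, each \<open>x \<in> X\<close> has only finitely many images under the maps
  \<open>\<lambda>\<^sub>c\<close>, so the set \<open>Y\<close> of all images of \<open>X\<close> under \<open>\<lambda>\<^sub>c\<close> with \<open>c \<in> C\<close> is finite.  Its invariance
  under \<open>\<lambda>\<close> makes \<open>Y\<close> generate both groups \<open>(C,+)\<close> and \<open>(C,\<circ>)\<close>
  (\<open>fg_brace_group_generators\<close>).

  Cosets: for finite \<open>Y\<close>, the elements of \<open>B\<close> fall into finitely many classes according to
  their cosets modulo the subgroups \<open>Fix_r y \<inter> C\<^sub>y\<^sup>+\<close> and \<open>Fix_l y \<inter> C\<^sub>y\<^sup>\<circ>\<close>, \<open>y \<in> Y\<close>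
  (\<open>finite_range_coset_key\<close>).  If \<open>b\<close> and \<open>c\<close> are in one class, then \<open>l = b - c\<close> satisfies
  \<open>l + z = z + l = z \<circ> l\<close> and \<open>k = b \<circ> c\<^sup>-\<^sup>1\<close> satisfies \<open>k \<circ> z = z \<circ> k = k + z\<close> for all \<open>z\<close> that
  \<open>Y\<close> generates in both groups
  (\<open>Fix_r_centralizer_generated\<close>, \<open>Fix_l_centralizer_generated\<close>).

  Suppose that \<open>B\<close> is its own hyper-annihilator, and let \<open>C\<close> be finitely generated, with group
  generators \<open>Y\<close>.  For two elements of \<open>C\<close> in one class, \<open>k = l\<close> lies in \<open>Ann(C)\<close>; thus
  \<open>Ann(C)\<close> has finite index in \<open>C\<close>, and the annihilator series of \<open>C\<close> stops at some finite
  \<open>n\<close>.  An ideal of \<open>C\<close> at which that series stops contains the intersection of \<open>C\<close> with every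
  term of the series of \<open>B\<close> (\<open>Ann_series_subset_fixed\<close>), so \<open>C = Ann\<^sub>n(C)\<close>.

  Suppose conversely that \<open>B\<close> is locally annihilator-nilpotent and that some \<open>x\<close> lies outside
  the hyper-annihilator \<open>H\<close>.  The ideal \<open>N\<close> generated by \<open>x\<close> is a finitely generated skew
  brace because \<open>B\<close> is good; let \<open>Y\<close> generate both of its groups, let \<open>T\<close> represent the
  classes, and let \<open>F\<close> be the sub-skew brace generated by \<open>Y \<union> T\<close>.  Then \<open>F\<close> contains \<open>N\<close>
  and is annihilator nilpotent, so there is a first term of its series that meets \<open>N\<close> outside
  \<open>H\<close>, say in \<open>z\<close>.  This \<open>z\<close> is annihilating modulo \<open>H\<close> for the elements of \<open>F\<close>, in
  particular for those of \<open>T\<close>; every element of \<open>B\<close> differs from one of \<open>T\<close> by some \<open>l\<close> and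
  some \<open>k\<close> as above, for which \<open>z\<close> is annihilating exactly.  Hence \<open>z\<close> belongs to the next
  term of the series after \<open>H\<close>, which is \<open>H\<close> itself: a contradiction.
\<close>

section \<open>Calculating in a skew brace\<close>

sublocale skew_brace < add: group "add_monoid B"
  rewrites "carrier (add_monoid B) = carrier B"
    and "mult (add_monoid B) = add B"
    and "one (add_monoid B) = zero B"
    and "m_inv (add_monoid B) = a_inv B"
  by (rule add_group) (auto simp: a_inv_def)

sublocale skew_brace < group B
  by (rule mult_group)

context skew_brace
begin

abbreviation lam :: "'a \<Rightarrow> 'a \<Rightarrow> 'a" where
  "lam \<equiv> brace_lambda B"

lemma one_eq_zero [simp]: "\<one> = \<zero>"
proof -
  have "\<one> \<otimes> (\<zero> \<oplus> \<zero>) = \<one> \<otimes> \<zero> \<ominus> \<one> \<oplus> \<one> \<otimes> \<zero>"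
    by (rule brace_distrib) auto
  then have "\<zero> \<ominus> \<one> = \<zero>"
    by (simp add: a_minus_def)
  then show ?thesis
    by (metis a_minus_def add.inv_closed add.inv_equality add.l_one add.r_inv one_closed)
qed

lemma zero_mult [simp]: "a \<in> carrier B \<Longrightarrow> \<zero> \<otimes> a = a"
  and mult_zero [simp]: "a \<in> carrier B \<Longrightarrow> a \<otimes> \<zero> = a"
  and inv_zero [simp]: "inv \<zero> = \<zero>"
  and inv_mult_zero [simp]: "a \<in> carrier B \<Longrightarrow> inv a \<otimes> a = \<zero>"
  and mult_inv_zero [simp]: "a \<in> carrier B \<Longrightarrow> a \<otimes> inv a = \<zero>"
  using l_one[of a] r_one[of a] inv_one l_inv[of a] r_inv[of a] by simp_all

lemma lam_closed [simp, intro]: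
  "a \<in> carrier B \<Longrightarrow> b \<in> carrier B \<Longrightarrow> lam a b \<in> carrier B"
  by (simp add: brace_lambda_def)

lemma mult_eq_add_lam:
  "a \<in> carrier B \<Longrightarrow> b \<in> carrier B \<Longrightarrow> a \<otimes> b = a \<oplus> lam a b"
  by (simp add: brace_lambda_def flip: add.m_assoc)

lemma lam_eqI:
  "a \<otimes> b = a \<oplus> c \<Longrightarrow> a \<in> carrier B \<Longrightarrow> b \<in> carrier B \<Longrightarrow> c \<in> carrier B \<Longrightarrow> lam a b = c"
  by (metis add.Units_l_cancel add.Units_eq lam_closed mult_eq_add_lam)

lemma lam_add:
  assumes "a \<in> carrier B" "b \<in> carrier B" "c \<in> carrier B"
  shows "lam a (b \<oplus> c) = lam a b \<oplus> lam a c"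
  using assms by (simp add: brace_lambda_def brace_distrib a_minus_def add.m_assoc)

lemma lam_mult:
  assumes "a \<in> carrier B" "b \<in> carrier B" "c \<in> carrier B"
  shows "lam (a \<otimes> b) c = lam a (lam b c)"
proof (rule lam_eqI)
  have "a \<otimes> b \<otimes> c = a \<otimes> (b \<oplus> lam b c)"
    using assms by (simp add: m_assoc mult_eq_add_lam[of b c])
  also have "\<dots> = a \<oplus> (lam a b \<oplus> lam a (lam b c))"
    using assms by (simp add: mult_eq_add_lam lam_add)
  also have "\<dots> = a \<otimes> b \<oplus> lam a (lam b c)"
    using assms by (simp add: mult_eq_add_lam add.m_assoc)
  finally show "a \<otimes> b \<otimes> c = a \<otimes> b \<oplus> lam a (lam b c)" .
qed (use assms in auto)

lemma lam_zero_left [simp]: "b \<in> carrier B \<Longrightarrow> lam \<zero> b = b"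
  by (simp add: brace_lambda_def)

lemma lam_zero_right [simp]: "a \<in> carrier B \<Longrightarrow> lam a \<zero> = \<zero>"
  by (simp add: brace_lambda_def)

lemma lam_neg:
  assumes "a \<in> carrier B" "b \<in> carrier B"
  shows "lam a (\<ominus> b) = \<ominus> lam a b"
  using lam_add[of a "\<ominus> b" b] assms
  by (metis add.inv_closed add.inv_equality add.l_inv lam_closed lam_zero_right)

lemma lam_inv_lam [simp]:
  "a \<in> carrier B \<Longrightarrow> b \<in> carrier B \<Longrightarrow> lam (inv a) (lam a b) = b"
  and lam_lam_inv [simp]:
  "a \<in> carrier B \<Longrightarrow> b \<in> carrier B \<Longrightarrow> lam a (lam (inv a) b) = b"
  by (simp_all flip: lam_mult)

lemma add_eq_mult_lam:
  "a \<in> carrier B \<Longrightarrow> b \<in> carrier B \<Longrightarrow> a \<oplus> b = a \<otimes> lam (inv a) b"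
  by (simp add: mult_eq_add_lam)

lemma inv_eq_neg_lam:
  assumes "a \<in> carrier B"
  shows "inv a = \<ominus> lam (inv a) a"
proof -
  have "inv a \<oplus> lam (inv a) a = \<zero>"
    using assms by (simp flip: mult_eq_add_lam)
  then show ?thesis
    using assms by (simp add: add.inv_equality)
qed

lemma mem_Fix_r_iff:
  "x \<in> carrier B \<Longrightarrow> b \<in> Fix_r B x \<longleftrightarrow> b \<in> carrier B \<and> x \<otimes> b = x \<oplus> b"
  and mem_Fix_l_iff:
  "x \<in> carrier B \<Longrightarrow> b \<in> Fix_l B x \<longleftrightarrow> b \<in> carrier B \<and> b \<otimes> x = b \<oplus> x"
  by (auto simp: Fix_r_def Fix_l_def brace_star_def a_minus_def mult_eq_add_lam
      dest: add.inv_equality)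

lemma subgroup_Fix_r:
  assumes "x \<in> carrier B"
  shows "subgroup (Fix_r B x) (add_monoid B)"
proof (rule add.subgroupI)
  show "\<ominus> a \<in> Fix_r B x" if "a \<in> Fix_r B x" for a
    using that assms by (auto simp: mem_Fix_r_iff mult_eq_add_lam lam_neg)
  show "a \<oplus> b \<in> Fix_r B x" if "a \<in> Fix_r B x" "b \<in> Fix_r B x" for a b
    using that assms by (auto simp: mem_Fix_r_iff mult_eq_add_lam lam_add)
  have "\<zero> \<in> Fix_r B x"
    using assms by (simp add: mem_Fix_r_iff)
  then show "Fix_r B x \<noteq> {}"
    by blast
qed (auto simp: Fix_r_def)

lemma subgroup_Fix_l:
  assumes x: "x \<in> carrier B"
  shows "subgroup (Fix_l B x) B"
proof (rule subgroupI)
  show "inv a \<in> Fix_l B x" if "a \<in> Fix_l B x" for a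
    using that x by (auto simp: mem_Fix_l_iff mult_eq_add_lam) (metis lam_inv_lam)
  show "a \<otimes> b \<in> Fix_l B x" if "a \<in> Fix_l B x" "b \<in> Fix_l B x" for a b
  proof -
    have "a \<in> carrier B" "b \<in> carrier B" "lam a x = x" "lam b x = x"
      using that x by (auto simp: mem_Fix_l_iff mult_eq_add_lam)
    then show ?thesis
      using x by (simp add: mem_Fix_l_iff mult_eq_add_lam[of "a \<otimes> b"] lam_mult)
  qed
  have "\<zero> \<in> Fix_l B x"
    using x by (simp add: mem_Fix_l_iff)
  then show "Fix_l B x \<noteq> {}"
    by blast
qed (auto simp: Fix_l_def)

end

lemma (in group) subgroup_centralizer:
  assumes x: "x \<in> carrier G"
  shows "subgroup (centralizer G x) G"
proof (rule subgroupI)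
  show "inv a \<in> centralizer G x" if "a \<in> centralizer G x" for a
    using that x by (auto simp: centralizer_def) (metis inv_solve_left inv_solve_right m_assoc m_closed inv_closed)
  show "a \<otimes> b \<in> centralizer G x" if "a \<in> centralizer G x" "b \<in> centralizer G x" for a b
    using that x by (auto simp: centralizer_def) (metis m_assoc)
  have "\<one> \<in> centralizer G x"
    using x by (simp add: centralizer_def)
  then show "centralizer G x \<noteq> {}"
    by blast
qed (auto simp: centralizer_def)


section \<open>Ideals and quotients\<close>

context skew_brace
begin

text \<open>By \<open>a \<circ> b = a + \<lambda>\<^sub>a(b)\<close> and \<open>a\<^sup>-\<^sup>1 = -\<lambda>\<^sub>c(a)\<close> with \<open>c = a\<^sup>-\<^sup>1\<close>, a \<open>\<lambda>\<close>-invariant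
  additive subgroup is automatically a subgroup of \<open>(B,\<circ>)\<close>.\<close>

lemma brace_idealI:
  assumes sub: "subgroup I (add_monoid B)"
    and add_conj: "\<And>x h. x \<in> carrier B \<Longrightarrow> h \<in> I \<Longrightarrow> x \<oplus> h \<oplus> \<ominus> x \<in> I"
    and mult_conj: "\<And>x h. x \<in> carrier B \<Longrightarrow> h \<in> I \<Longrightarrow> x \<otimes> h \<otimes> inv x \<in> I"
    and lam: "\<And>x h. x \<in> carrier B \<Longrightarrow> h \<in> I \<Longrightarrow> lam x h \<in> I"
  shows "brace_ideal B I"
proof -
  note I = subgroup.subset[OF sub, simplified]
  have "subgroup I B"
  proof (rule subgroupI)
    show "I \<noteq> {}"
      using subgroup.one_closed[OF sub] by auto
    show "inv a \<in> I" if "a \<in> I" for a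
      using subgroup.m_inv_closed[OF sub, of "lam (inv a) a"] that I lam[of "inv a" a]
      by (subst inv_eq_neg_lam) (auto simp: a_inv_def)
    show "a \<otimes> b \<in> I" if "a \<in> I" "b \<in> I" for a b
      using subgroup.m_closed[OF sub, of a "lam a b"] that I lam[of a b]
      by (subst mult_eq_add_lam) auto
  qed (fact I)
  with assms show ?thesis
    by (auto simp: brace_ideal_def normal_inv_iff add.normal_inv_iff)
qed

lemma
  assumes "brace_ideal B I"
  shows brace_ideal_add_subgroup: "subgroup I (add_monoid B)"
    and brace_ideal_mult_subgroup: "subgroup I B"
    and brace_ideal_subset: "I \<subseteq> carrier B"
    and brace_ideal_add_conj: "\<And>x h. x \<in> carrier B \<Longrightarrow> h \<in> I \<Longrightarrow> x \<oplus> h \<oplus> \<ominus> x \<in> I"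
    and brace_ideal_mult_conj: "\<And>x h. x \<in> carrier B \<Longrightarrow> h \<in> I \<Longrightarrow> x \<otimes> h \<otimes> inv x \<in> I"
    and brace_ideal_lam: "\<And>x h. x \<in> carrier B \<Longrightarrow> h \<in> I \<Longrightarrow> lam x h \<in> I"
    and brace_ideal_sub_skew_brace: "sub_skew_brace B I"
  using assms subgroup.subset[of I B]
  by (auto simp: brace_ideal_def normal_inv_iff add.normal_inv_iff sub_skew_brace_def image_subset_iff)

lemma zero_in_brace_ideal: "brace_ideal B I \<Longrightarrow> \<zero> \<in> I"
  using subgroup.one_closed[OF brace_ideal_add_subgroup] by simp

lemma coset_eq_iff:
  assumes I: "subgroup I (add_monoid B)" and uv: "u \<in> carrier B" "v \<in> carrier B"
  shows "I +> u = I +> v \<longleftrightarrow> (\<exists>i\<in>I. u = i \<oplus> v)"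
proof
  assume "I +> u = I +> v"
  then have "u \<in> I +> v"
    using add.rcos_self[of u I] I uv by (simp add: a_r_coset_def)
  then show "\<exists>i\<in>I. u = i \<oplus> v"
    by (auto simp: a_r_coset_def r_coset_def)
next
  assume "\<exists>i\<in>I. u = i \<oplus> v"
  then have "u \<in> I +> v"
    by (auto simp: a_r_coset_def r_coset_def)
  then show "I +> u = I +> v"
    using add.repr_independence[of u I v] I uv by (simp add: a_r_coset_def)
qed

lemma coset_eq_self_iff:
  assumes "brace_ideal B I" "u \<in> carrier B"
  shows "I +> u = I +> \<zero> \<longleftrightarrow> u \<in> I"
  using assms brace_ideal_subset[OF assms(1)]
  by (subst coset_eq_iff[OF brace_ideal_add_subgroup]) (force simp: subset_iff)+

text \<open>Both cosets are also left cosets, \<open>a + I\<close> and \<open>a \<circ> I\<close>, and these agree because \<open>\<lambda>\<^sub>a\<close>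
  permutes \<open>I\<close>.  This makes \<open>\<circ>\<close> well defined on the additive cosets.\<close>

lemma add_coset_eq_mult_coset:
  assumes I: "brace_ideal B I" and a: "a \<in> carrier B"
  shows "I +> a = I #> a"
proof -
  note sub = brace_ideal_subset[OF I, THEN subsetD]
  have "I +> a = {a \<oplus> i | i. i \<in> I}"
    using I a normal.coset_eq[of I "add_monoid B"]
    by (auto simp: brace_ideal_def a_r_coset_def l_coset_def)
  also have "\<dots> = {a \<otimes> i | i. i \<in> I}"
  proof -
    have "\<exists>j\<in>I. a \<oplus> i = a \<otimes> j" "\<exists>j\<in>I. a \<otimes> i = a \<oplus> j" if "i \<in> I" for i
      using that a sub add_eq_mult_lam[of a i] mult_eq_add_lam[of a i] brace_ideal_lam[OF I]
      by auto
    then show ?thesis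
      by auto
  qed
  also have "\<dots> = I #> a"
    using I a normal.coset_eq[of I B] by (auto simp: brace_ideal_def l_coset_def)
  finally show ?thesis .
qed

lemma carrier_quot: "carrier (B Quot I) = (+>) I ` carrier B"
  and zero_quot: "zero (B Quot I) = I"
  by (simp_all add: FactRing_def A_RCOSETS_def RCOSETS_def a_r_coset_def UNION_singleton_eq_range)

lemma add_quot:
  assumes "brace_ideal B I" "a \<in> carrier B" "b \<in> carrier B"
  shows "(I +> a) \<oplus>\<^bsub>B Quot I\<^esub> (I +> b) = I +> (a \<oplus> b)"
  using assms normal.rcos_sum[of I "add_monoid B" a b]
  by (simp add: FactRing_def set_add_def a_r_coset_def brace_ideal_def)

lemma mult_quot:
  assumes I: "brace_ideal B I" and ab: "a \<in> carrier B" "b \<in> carrier B"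
  shows "(I +> a) \<otimes>\<^bsub>B Quot I\<^esub> (I +> b) = I +> (a \<otimes> b)"
proof -
  have *: "I +> (a' \<otimes> b') = I +> (a \<otimes> b)" if "a' \<in> I +> a" "b' \<in> I +> b" for a' b'
  proof -
    have "a' \<otimes> b' \<in> (I #> a) <#> (I #> b)"
      using that I ab by (auto simp: add_coset_eq_mult_coset set_mult_def)
    also have "\<dots> = I #> (a \<otimes> b)"
      using I ab by (simp add: brace_ideal_def normal.rcos_sum)
    finally have *: "a' \<otimes> b' \<in> I #> (a \<otimes> b)" .
    then have "a' \<otimes> b' \<in> carrier B"
      using r_coset_subset_G[of I "a \<otimes> b"] brace_ideal_subset[OF I] ab by auto
    with * show ?thesis
      using repr_independence[of "a' \<otimes> b'" I "a \<otimes> b"] I ab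
      by (simp add: add_coset_eq_mult_coset brace_ideal_mult_subgroup)
  qed
  have "a \<in> I +> a" "b \<in> I +> b"
    using add.rcos_self[of _ I] ab brace_ideal_add_subgroup[OF I] by (auto simp: a_r_coset_def)
  then have "(\<Union>a'\<in>I +> a. \<Union>b'\<in>I +> b. I +> (a' \<otimes> b')) = I +> (a \<otimes> b)"
    using * by blast
  then show ?thesis
    by (simp add: FactRing_def rcoset_mult_def)
qed

lemma coset_add_cong:
  assumes "brace_ideal B I" "I +> a = I +> a'" "I +> b = I +> b'"
    "a \<in> carrier B" "a' \<in> carrier B" "b \<in> carrier B" "b' \<in> carrier B"
  shows "I +> (a \<oplus> b) = I +> (a' \<oplus> b')"
  using assms by (metis add_quot)

lemma coset_mult_cong:
  assumes "brace_ideal B I" "I +> a = I +> a'" "I +> b = I +> b'"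
    "a \<in> carrier B" "a' \<in> carrier B" "b \<in> carrier B" "b' \<in> carrier B"
  shows "I +> (a \<otimes> b) = I +> (a' \<otimes> b')"
  using assms by (metis mult_quot)

lemma skew_brace_quot:
  assumes I: "brace_ideal B I"
  shows "skew_brace (B Quot I)"
proof -
  let ?Q = "B Quot I"
  note simps = carrier_quot zero_quot add_quot[OF I] mult_quot[OF I]
  have I_eq: "I = I +> \<zero>"
    using brace_ideal_subset[OF I] by (auto simp: a_r_coset_def r_coset_def) (metis add.r_one subsetD)
  have one: "one ?Q = I +> \<zero>"
    by (simp add: FactRing_def)
  have add: "group (add_monoid ?Q)"
  proof (rule groupI; simp; unfold simps)
    show "I \<in> (+>) I ` carrier B"
      using I_eq by blast
    show "\<exists>y\<in>(+>) I ` carrier B. y \<oplus>\<^bsub>?Q\<^esub> x = I" if "x \<in> (+>) I ` carrier B" for x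
    proof -
      from that obtain a where a: "a \<in> carrier B" "x = I +> a"
        by blast
      then have "(I +> \<ominus> a) \<oplus>\<^bsub>?Q\<^esub> x = I"
        using I_eq by (simp add: simps)
      with a show ?thesis
        by blast
    qed
    show "I \<oplus>\<^bsub>?Q\<^esub> x = x" if "x \<in> (+>) I ` carrier B" for x
      using that by (subst I_eq) (auto simp: simps)
  qed (auto simp: simps add.m_assoc)
  have mult: "group ?Q"
  proof (rule groupI; unfold one simps(1))
    show "\<exists>y\<in>(+>) I ` carrier B. y \<otimes>\<^bsub>?Q\<^esub> x = I +> \<zero>" if "x \<in> (+>) I ` carrier B" for x
    proof -
      from that obtain a where a: "a \<in> carrier B" "x = I +> a"
        by blast
      then have "(I +> inv a) \<otimes>\<^bsub>?Q\<^esub> x = I +> \<zero>"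
        by (simp add: simps)
      with a show ?thesis
        by blast
    qed
  qed (auto simp: simps m_assoc)
  have neg: "\<ominus>\<^bsub>?Q\<^esub> (I +> a) = I +> \<ominus> a" if "a \<in> carrier B" for a
    unfolding a_inv_def[of ?Q]
    by (rule group.inv_equality[OF add]) (use that I_eq in \<open>auto simp: simps\<close>)
  show ?thesis
    by (rule skew_brace.intro[OF add mult])
       (auto simp: carrier_quot a_minus_def neg add_quot[OF I] mult_quot[OF I] brace_distrib)
qed

text \<open>This form of \<open>Ann\<close> involves only the two operations, so it passes to cosets and to
  sub-skew braces without any calculation with inverses.\<close>

lemma mem_Ann_iff:
  "a \<in> Ann B \<longleftrightarrow> a \<in> carrier B \<and>
    (\<forall>b\<in>carrier B. a \<otimes> b = a \<oplus> b \<and> b \<oplus> a = a \<oplus> b \<and> b \<otimes> a = a \<otimes> b)"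
proof -
  have "lam a b = b \<longleftrightarrow> a \<otimes> b = a \<oplus> b" if "a \<in> carrier B" "b \<in> carrier B" for b
    using that by (auto simp: mult_eq_add_lam)
  then show ?thesis
    unfolding Ann_def center_def Int_iff mem_Collect_eq by (simp only: monoid.simps partial_object.simps) metis
qed

lemma add_subgroup_Ann: "subgroup (Ann B) (add_monoid B)"
proof (rule add.subgroupI)
  show "\<ominus> a \<in> Ann B" if a: "a \<in> Ann B" for a
  proof -
    have aB: "a \<in> carrier B"
      using a by (simp add: mem_Ann_iff)
    have neg: "inv a = \<ominus> a"
      using a aB by (intro inv_equality) (auto simp: mem_Ann_iff add.r_inv)
    have "\<ominus> a \<otimes> b = \<ominus> a \<oplus> b" if b: "b \<in> carrier B" for b
    proof -
      have "a \<otimes> (\<ominus> a \<oplus> b) = b"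
        using a aB b by (simp add: mem_Ann_iff flip: add.m_assoc)
      then have "inv a \<otimes> b = \<ominus> a \<oplus> b"
        using aB b by (metis add.inv_closed add.m_closed inv_solve_left)
      then show ?thesis
        by (simp add: neg)
    qed
    moreover have "b \<oplus> \<ominus> a = \<ominus> a \<oplus> b" if b: "b \<in> carrier B" for b
    proof -
      have "b \<oplus> a = a \<oplus> b"
        using a b by (simp add: mem_Ann_iff)
      then show ?thesis
        using aB b by (metis add.inv_closed add.inv_solve_left add.inv_solve_right add.m_assoc add.m_closed)
    qed
    moreover have "b \<otimes> inv a = inv a \<otimes> b" if b: "b \<in> carrier B" for b
    proof -
      have "b \<otimes> a = a \<otimes> b"
        using a b by (simp add: mem_Ann_iff)
      then show ?thesis
        using aB b by (metis inv_closed inv_solve_left inv_solve_right m_assoc m_closed)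
    qed
    ultimately show ?thesis
      using aB by (simp add: mem_Ann_iff neg)
  qed
  show "a \<oplus> a' \<in> Ann B" if a: "a \<in> Ann B" "a' \<in> Ann B" for a a'
  proof -
    have aB: "a \<in> carrier B" "a' \<in> carrier B"
      and eq: "\<And>b. b \<in> carrier B \<Longrightarrow> a \<otimes> b = a \<oplus> b" "\<And>b. b \<in> carrier B \<Longrightarrow> b \<oplus> a = a \<oplus> b"
        "\<And>b. b \<in> carrier B \<Longrightarrow> b \<otimes> a = a \<oplus> b"
        "\<And>b. b \<in> carrier B \<Longrightarrow> a' \<otimes> b = a' \<oplus> b" "\<And>b. b \<in> carrier B \<Longrightarrow> b \<oplus> a' = a' \<oplus> b"
        "\<And>b. b \<in> carrier B \<Longrightarrow> b \<otimes> a' = a' \<oplus> b"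
      using a by (auto simp: mem_Ann_iff)
    have "(a \<oplus> a') \<otimes> b = (a \<oplus> a') \<oplus> b \<and> b \<oplus> (a \<oplus> a') = (a \<oplus> a') \<oplus> b
        \<and> b \<otimes> (a \<oplus> a') = (a \<oplus> a') \<oplus> b" if b: "b \<in> carrier B" for b
    proof (intro conjI)
      have "(a \<otimes> a') \<otimes> b = a \<otimes> (a' \<otimes> b)"
        using aB b by (rule m_assoc)
      then show "(a \<oplus> a') \<otimes> b = (a \<oplus> a') \<oplus> b"
        using aB b by (simp add: eq(1,4) add.m_assoc)
      show "b \<oplus> (a \<oplus> a') = (a \<oplus> a') \<oplus> b"
        using aB b eq(2)[OF b] eq(5)[OF b] by (metis add.m_assoc)
      have "b \<otimes> (a \<otimes> a') = (b \<otimes> a) \<otimes> a'"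
        using aB b by (simp add: m_assoc)
      also have "\<dots> = (a \<oplus> a') \<oplus> b"
        using aB b by (simp add: eq(3,6)) (metis add.m_assoc eq(2))
      finally show "b \<otimes> (a \<oplus> a') = (a \<oplus> a') \<oplus> b"
        using aB by (simp add: eq(1))
    qed
    with aB show ?thesis
      by (simp add: mem_Ann_iff)
  qed
  have "\<zero> \<in> Ann B"
    by (simp add: mem_Ann_iff)
  then show "Ann B \<noteq> {}"
    by blast
qed (auto simp: mem_Ann_iff)

end

text \<open>The equations that characterise the annihilator, read modulo \<open>I\<close>.  The carrier does not
  occur in them, which allows the same relation to be used for a skew brace and its sub-skew
  braces.\<close>

definition trivial_mod :: "('a, 'm) ring_scheme \<Rightarrow> 'a set \<Rightarrow> 'a \<Rightarrow> 'a \<Rightarrow> bool" where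
  "trivial_mod R I a b \<longleftrightarrow>
     I +>\<^bsub>R\<^esub> (a \<otimes>\<^bsub>R\<^esub> b) = I +>\<^bsub>R\<^esub> (a \<oplus>\<^bsub>R\<^esub> b) \<and>
     I +>\<^bsub>R\<^esub> (b \<oplus>\<^bsub>R\<^esub> a) = I +>\<^bsub>R\<^esub> (a \<oplus>\<^bsub>R\<^esub> b) \<and>
     I +>\<^bsub>R\<^esub> (b \<otimes>\<^bsub>R\<^esub> a) = I +>\<^bsub>R\<^esub> (a \<oplus>\<^bsub>R\<^esub> b)"

lemma coset_carrier_update [simp]: "I +>\<^bsub>R\<lparr>carrier := C\<rparr>\<^esub> a = I +>\<^bsub>R\<^esub> a"
  by (simp add: a_r_coset_def r_coset_def)

lemma trivial_mod_carrier_update [simp]: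
  "trivial_mod (R\<lparr>carrier := C\<rparr>) I a b = trivial_mod R I a b"
  by (simp add: trivial_mod_def)

context skew_brace
begin

lemma mem_Ann_next_iff:
  assumes I: "brace_ideal B I"
  shows "a \<in> Ann_next B I \<longleftrightarrow> a \<in> carrier B \<and> (\<forall>b\<in>carrier B. trivial_mod B I a b)"
proof -
  interpret Q: skew_brace "B Quot I"
    by (rule skew_brace_quot[OF I])
  have "I +> a \<in> Ann (B Quot I) \<longleftrightarrow> (\<forall>b\<in>carrier B. trivial_mod B I a b)" if "a \<in> carrier B"
    using that by (auto simp: Q.mem_Ann_iff carrier_quot add_quot[OF I] mult_quot[OF I] trivial_mod_def)
  then show ?thesis
    by (auto simp: Ann_next_def)
qed

text \<open>\<open>Ann_next B I\<close> is the preimage of an additive subgroup of the quotient.  It is normal and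
  \<open>\<lambda>\<close>-invariant because conjugation and \<open>\<lambda>\<close> move its elements only inside their cosets of \<open>I\<close>.\<close>

lemma brace_ideal_Ann_next:
  assumes I: "brace_ideal B I"
  shows "brace_ideal B (Ann_next B I)"
proof -
  interpret Q: skew_brace "B Quot I"
    by (rule skew_brace_quot[OF I])
  have hom: "group_hom (add_monoid B) (add_monoid (B Quot I)) ((+>) I)"
    by (intro group_hom.intro group_hom_axioms.intro add_group Q.add_group)
       (simp add: hom_def carrier_quot add_quot[OF I])
  have neg: "I +> \<ominus> a = \<ominus>\<^bsub>B Quot I\<^esub> (I +> a)" if "a \<in> carrier B" for a
    using group_hom.hom_inv[OF hom, of a] that by (simp add: a_inv_def)
  note Ann_closed = subgroup.m_closed[OF Q.add_subgroup_Ann, simplified]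
    subgroup.m_inv_closed[OF Q.add_subgroup_Ann, folded a_inv_def]
    subgroup.one_closed[OF Q.add_subgroup_Ann, simplified]
  have same_coset: "u \<in> Ann_next B I"
    if "I +> u = I +> a" "a \<in> Ann_next B I" "u \<in> carrier B" for u a
    using that by (simp add: Ann_next_def)
  have zero: "I +> \<zero> = zero (B Quot I)"
    using group_hom.hom_one[OF hom] by simp
  show ?thesis
  proof (rule brace_idealI)
    show "subgroup (Ann_next B I) (add_monoid B)"
    proof (rule add.subgroupI)
      show "\<ominus> a \<in> Ann_next B I" if "a \<in> Ann_next B I" for a
        using that Ann_closed by (auto simp: Ann_next_def neg)
      show "a \<oplus> b \<in> Ann_next B I" if "a \<in> Ann_next B I" "b \<in> Ann_next B I" for a b
        using that Ann_closed by (auto simp: Ann_next_def simp flip: add_quot[OF I])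
      have "\<zero> \<in> Ann_next B I"
        using Ann_closed by (auto simp: Ann_next_def zero)
      then show "Ann_next B I \<noteq> {}"
        by blast
    qed (auto simp: Ann_next_def)
  next
    fix x h
    assume x: "x \<in> carrier B" and h: "h \<in> Ann_next B I"
    then have hB: "h \<in> carrier B" and tr: "trivial_mod B I h x"
      by (auto simp: mem_Ann_next_iff[OF I])
    have "I +> (x \<oplus> h \<oplus> \<ominus> x) = I +> (h \<oplus> x \<oplus> \<ominus> x)"
      using tr x hB coset_add_cong[OF I, of "x \<oplus> h" "h \<oplus> x" "\<ominus> x" "\<ominus> x"]
      by (simp add: trivial_mod_def)
    also have "\<dots> = I +> h"
      using x hB by (simp add: add.m_assoc add.r_inv)
    finally show "x \<oplus> h \<oplus> \<ominus> x \<in> Ann_next B I"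
      using same_coset h x hB by auto
    have "I +> (x \<otimes> h \<otimes> inv x) = I +> (h \<otimes> x \<otimes> inv x)"
      using tr x hB coset_mult_cong[OF I, of "x \<otimes> h" "h \<otimes> x" "inv x" "inv x"]
      by (simp add: trivial_mod_def)
    also have "\<dots> = I +> h"
      using x hB by (simp add: m_assoc)
    finally show "x \<otimes> h \<otimes> inv x \<in> Ann_next B I"
      using same_coset h x hB by auto
    have "I +> lam x h = I +> (\<ominus> x \<oplus> (x \<oplus> h))"
      unfolding brace_lambda_def
      using tr x hB coset_add_cong[OF I, of "\<ominus> x" "\<ominus> x" "x \<otimes> h" "x \<oplus> h"]
      by (simp add: trivial_mod_def)
    also have "\<dots> = I +> h"
      using x hB by (simp flip: add.m_assoc)
    finally show "lam x h \<in> Ann_next B I"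
      using same_coset h x hB by auto
  qed
qed

lemma Ann_next_superset:
  assumes I: "brace_ideal B I"
  shows "I \<subseteq> Ann_next B I"
proof
  fix i assume i: "i \<in> I"
  then have iB: "i \<in> carrier B" and i0: "I +> i = I +> \<zero>"
    using brace_ideal_subset[OF I] coset_eq_self_iff[OF I] by auto
  have "trivial_mod B I i b" if b: "b \<in> carrier B" for b
  proof -
    have "I +> (i \<oplus> b) = I +> (\<zero> \<oplus> b)" "I +> (b \<oplus> i) = I +> (b \<oplus> \<zero>)"
      "I +> (i \<otimes> b) = I +> (\<zero> \<otimes> b)" "I +> (b \<otimes> i) = I +> (b \<otimes> \<zero>)"
      using iB b i0 by (intro coset_add_cong[OF I] coset_mult_cong[OF I]; simp)+
    with b show ?thesis
      by (simp add: trivial_mod_def)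
  qed
  with iB show "i \<in> Ann_next B I"
    by (simp add: mem_Ann_next_iff[OF I])
qed

lemma brace_ideal_Inter:
  assumes "\<And>I. I \<in> A \<Longrightarrow> brace_ideal B I" and "A \<noteq> {}"
  shows "brace_ideal B (\<Inter>A)"
proof (rule brace_idealI)
  show "subgroup (\<Inter>A) (add_monoid B)"
    using assms by (intro add.subgroups_Inter) (auto intro: brace_ideal_add_subgroup)
qed (use assms in \<open>simp_all add: brace_ideal_add_conj brace_ideal_mult_conj brace_ideal_lam\<close>)

lemma brace_ideal_zero: "brace_ideal B {\<zero>}"
proof (rule brace_idealI)
  show "subgroup {\<zero>} (add_monoid B)"
    by (rule add.subgroupI) auto
qed (auto simp: add.r_inv)

lemma brace_ideal_carrier: "brace_ideal B (carrier B)"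
proof (rule brace_idealI)
  show "subgroup (carrier B) (add_monoid B)"
    by (rule add.subgroupI) auto
qed auto

lemma brace_ideal_Union_chain:
  assumes ideal: "\<And>I. I \<in> A \<Longrightarrow> brace_ideal B I" and "A \<noteq> {}"
    and chain: "\<And>I J. I \<in> A \<Longrightarrow> J \<in> A \<Longrightarrow> I \<subseteq> J \<or> J \<subseteq> I"
  shows "brace_ideal B (\<Union>A)"
proof (rule brace_idealI)
  show "subgroup (\<Union>A) (add_monoid B)"
  proof (rule add.subgroupI)
    show "\<Union>A \<subseteq> carrier B"
      using ideal brace_ideal_subset by blast
    show "\<Union>A \<noteq> {}"
      using ideal zero_in_brace_ideal \<open>A \<noteq> {}\<close> by blast
    show "\<ominus> a \<in> \<Union>A" if "a \<in> \<Union>A" for a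
    proof -
      from that obtain I where "I \<in> A" "a \<in> I"
        by blast
      then show ?thesis
        using ideal subgroup.m_inv_closed[OF brace_ideal_add_subgroup, of I a, folded a_inv_def] by blast
    qed
    show "a \<oplus> b \<in> \<Union>A" if "a \<in> \<Union>A" "b \<in> \<Union>A" for a b
    proof -
      from that chain obtain I where "I \<in> A" "a \<in> I" "b \<in> I"
        by blast
      then show ?thesis
        using ideal subgroup.m_closed[OF brace_ideal_add_subgroup, of I a b] by (metis UnionI monoid.simps(1))
    qed
  qed
qed (use ideal brace_ideal_add_conj brace_ideal_mult_conj brace_ideal_lam in \<open>meson UnionE UnionI\<close>)+

end

section \<open>Sub-skew braces\<close>

context skew_brace
begin

lemma sub_skew_brace_subset: "sub_skew_brace B C \<Longrightarrow> C \<subseteq> carrier B"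
  using subgroup.subset[of C B] by (simp add: sub_skew_brace_def)

lemma skew_brace_sub:
  assumes C: "sub_skew_brace B C"
  shows "skew_brace (B\<lparr>carrier := C\<rparr>)"
proof -
  have sub: "subgroup C (add_monoid B)" "subgroup C B"
    using C by (simp_all add: sub_skew_brace_def)
  have neg: "\<ominus>\<^bsub>B\<lparr>carrier := C\<rparr>\<^esub> a = \<ominus> a" if "a \<in> C" for a
    using add.m_inv_consistent[OF sub(1) that] by (simp add: a_inv_def)
  show ?thesis
  proof (rule skew_brace.intro)
    show "group (add_monoid (B\<lparr>carrier := C\<rparr>))"
      using subgroup.subgroup_is_group[OF sub(1) add_group] by simp
    show "group (B\<lparr>carrier := C\<rparr>)"
      using subgroup.subgroup_is_group[OF sub(2) mult_group] by simp
  qed (use sub_skew_brace_subset[OF C] in \<open>auto simp: a_minus_def neg brace_distrib[unfolded a_minus_def] subset_iff\<close>)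
qed

lemma sub_skew_brace_Inter:
  assumes "\<And>C. C \<in> A \<Longrightarrow> sub_skew_brace B C" and "A \<noteq> {}"
  shows "sub_skew_brace B (\<Inter>A)"
  using assms add.subgroups_Inter[of A] subgroups_Inter[of A]
  by (simp add: sub_skew_brace_def)

lemma sub_skew_brace_carrier: "sub_skew_brace B (carrier B)"
  using brace_ideal_sub_skew_brace[OF brace_ideal_carrier] .

lemma sub_skew_brace_of_sub_iff:
  assumes C: "sub_skew_brace B C"
  shows "sub_skew_brace (B\<lparr>carrier := C\<rparr>) D \<longleftrightarrow> sub_skew_brace B D \<and> D \<subseteq> C"
proof
  assume D: "sub_skew_brace (B\<lparr>carrier := C\<rparr>) D"
  then show "sub_skew_brace B D \<and> D \<subseteq> C"
    using C incl_subgroup[of C D] add.incl_subgroup[of C D] subgroup.subset[of D "B\<lparr>carrier := C\<rparr>"]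
    by (simp add: sub_skew_brace_def)
next
  assume "sub_skew_brace B D \<and> D \<subseteq> C"
  then show "sub_skew_brace (B\<lparr>carrier := C\<rparr>) D"
    using C subgroup_incl[of D C] add.subgroup_incl[of D C]
    by (simp add: sub_skew_brace_def)
qed

lemma fg_brace_sub_iff:
  assumes C: "sub_skew_brace B C"
  shows "fg_brace (B\<lparr>carrier := C\<rparr>) \<longleftrightarrow>
    (\<exists>X. finite X \<and> X \<subseteq> C \<and> (\<forall>D. sub_skew_brace B D \<and> X \<subseteq> D \<longrightarrow> C \<subseteq> D))"
proof -
  have "C = sub_skew_brace (B\<lparr>carrier := C\<rparr>) hull X \<longleftrightarrow>
      (\<forall>D. sub_skew_brace B D \<and> X \<subseteq> D \<longrightarrow> C \<subseteq> D)" if X: "X \<subseteq> C" for X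
  proof
    assume hull: "C = sub_skew_brace (B\<lparr>carrier := C\<rparr>) hull X"
    show "\<forall>D. sub_skew_brace B D \<and> X \<subseteq> D \<longrightarrow> C \<subseteq> D"
    proof (intro allI impI)
      fix D assume D: "sub_skew_brace B D \<and> X \<subseteq> D"
      then have "sub_skew_brace (B\<lparr>carrier := C\<rparr>) (C \<inter> D)"
        using C sub_skew_brace_Inter[of "{C, D}"] by (auto simp: sub_skew_brace_of_sub_iff[OF C])
      then have "sub_skew_brace (B\<lparr>carrier := C\<rparr>) hull X \<subseteq> C \<inter> D"
        using X D by (intro hull_minimal) auto
      with hull show "C \<subseteq> D"
        by auto
    qed
  next
    assume least: "\<forall>D. sub_skew_brace B D \<and> X \<subseteq> D \<longrightarrow> C \<subseteq> D"
    show "C = sub_skew_brace (B\<lparr>carrier := C\<rparr>) hull X"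
      using X least C by (intro hull_unique[symmetric]) (auto simp: sub_skew_brace_of_sub_iff[OF C])
  qed
  then show ?thesis
    by (simp add: fg_brace_def cong: conj_cong)
qed

lemma obtain_fg_sub_skew_brace:
  assumes "finite X" "X \<subseteq> carrier B"
  obtains C where "sub_skew_brace B C" "X \<subseteq> C" "fg_brace (B\<lparr>carrier := C\<rparr>)"
proof -
  let ?C = "sub_skew_brace B hull X"
  have C: "sub_skew_brace B ?C"
    unfolding hull_def using sub_skew_brace_carrier assms by (intro sub_skew_brace_Inter) auto
  moreover have "X \<subseteq> ?C"
    by (rule hull_subset)
  moreover have "fg_brace (B\<lparr>carrier := ?C\<rparr>)"
    unfolding fg_brace_sub_iff[OF C]
    using \<open>finite X\<close> hull_subset[of X "sub_skew_brace B"] hull_minimal[of X _ "sub_skew_brace B"] by metis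
  ultimately show thesis
    by (rule that)
qed

lemma fg_ideal_hull:
  assumes "finite X" "X \<subseteq> carrier B"
  shows "fg_ideal B (brace_ideal B hull X)"
proof -
  have "brace_ideal B (brace_ideal B hull X)"
    unfolding hull_def using brace_ideal_carrier assms by (intro brace_ideal_Inter) auto
  with assms show ?thesis
    by (auto simp: fg_ideal_def)
qed

end

section \<open>The upper annihilator series\<close>

lemma Ann_series_cases [consumes 1, case_names zero succ limit]:
  assumes "Well_order r"
  obtains "underS r \<alpha> = {}" "Ann_series B r \<alpha> = {\<zero>\<^bsub>B\<^esub>}"
  | \<beta> where "\<beta> \<in> underS r \<alpha>" "underS r \<alpha> = under r \<beta>"
      "Ann_series B r \<alpha> = Ann_next B (Ann_series B r \<beta>)"
  | "underS r \<alpha> \<noteq> {}" "\<And>\<beta>. \<beta> \<in> underS r \<alpha> \<Longrightarrow> underS r \<alpha> \<noteq> under r \<beta>"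
      "Ann_series B r \<alpha> = (\<Union>\<gamma>\<in>underS r \<alpha>. Ann_series B r \<gamma>)"
  using Ann_series_zero[OF assms] Ann_series_succ[OF assms] Ann_series_limit[OF assms] that
  by metis

lemma Well_order_underS_induct [consumes 1, case_names less]:
  assumes "Well_order r" and "\<And>\<alpha>. (\<And>\<beta>. \<beta> \<in> underS r \<alpha> \<Longrightarrow> P \<beta>) \<Longrightarrow> P \<alpha>"
  shows "P \<alpha>"
proof -
  have "wo_rel r"
    using assms(1) by (simp add: wo_rel_def)
  then show ?thesis
    using assms(2) by (rule wo_rel.well_order_induct) (simp add: underS_def)
qed

lemma Well_order_underS_total:
  assumes "Well_order r" "\<beta> \<in> Field r" "\<gamma> \<in> Field r"
  shows "\<beta> \<in> underS r \<gamma> \<or> \<beta> = \<gamma> \<or> \<gamma> \<in> underS r \<beta>"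
proof -
  have "(\<beta>, \<gamma>) \<in> r \<or> (\<gamma>, \<beta>) \<in> r"
    using assms wo_rel.TOTALS[of r] by (simp add: wo_rel_def)
  then show ?thesis
    by (auto simp: underS_def)
qed

lemma Well_order_underS_trans:
  assumes "Well_order r" "\<beta> \<in> underS r \<gamma>" "\<gamma> \<in> underS r \<alpha>"
  shows "\<beta> \<in> underS r \<alpha>"
proof -
  have "trans r" "antisym r"
    using assms(1) wo_rel.TRANS[of r] wo_rel.ANTISYM[of r] by (simp_all add: wo_rel_def)
  moreover have "(\<beta>, \<gamma>) \<in> r" "(\<gamma>, \<alpha>) \<in> r" "\<gamma> \<noteq> \<alpha>"
    using assms by (auto simp: underS_def)
  ultimately show ?thesis
    unfolding underS_def by (auto dest: transD antisymD)
qed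

lemma mem_under_iff:
  assumes "Well_order r" "\<beta> \<in> Field r"
  shows "\<alpha> \<in> under r \<beta> \<longleftrightarrow> \<alpha> \<in> underS r \<beta> \<or> \<alpha> = \<beta>"
proof -
  have "(\<beta>, \<beta>) \<in> r"
    using assms wo_rel.REFL[of r] by (simp add: wo_rel_def refl_on_def)
  then show ?thesis
    by (auto simp: under_def underS_def)
qed

text \<open>At a limit stage this leaves room for one more step of the series above any earlier
  term.\<close>

lemma underS_limit_between:
  assumes r: "Well_order r" and \<beta>: "\<beta> \<in> underS r \<alpha>" and lim: "underS r \<alpha> \<noteq> under r \<beta>"
  obtains \<gamma> where "\<gamma> \<in> underS r \<alpha>" "\<beta> \<in> underS r \<gamma>"
proof -
  have field: "\<gamma> \<in> Field r" if "\<gamma> \<in> underS r \<alpha>" for \<gamma>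
    using that by (auto simp: underS_def Field_def)
  have "under r \<beta> \<subseteq> underS r \<alpha>"
    using \<beta> Well_order_underS_trans[OF r _ \<beta>] mem_under_iff[OF r field[OF \<beta>]] by blast
  with lim obtain \<gamma> where "\<gamma> \<in> underS r \<alpha>" "\<gamma> \<notin> under r \<beta>"
    by blast
  then show thesis
    using that Well_order_underS_total[OF r field[OF \<beta>] field] mem_under_iff[OF r field[OF \<beta>]] by blast
qed

context skew_brace
begin

text \<open>The two claims are proved together: a union of ideals at a limit stage is an ideal only
  because the earlier terms form a chain, and the terms increase only because
  \<open>Ann_next B I \<supseteq> I\<close> holds for ideals \<open>I\<close>.\<close>

lemma Ann_series_ideal_mono:
  assumes r: "Well_order r"
  shows "brace_ideal B (Ann_series B r \<alpha>) \<and>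
    (\<forall>\<beta>\<in>underS r \<alpha>. Ann_next B (Ann_series B r \<beta>) \<subseteq> Ann_series B r \<alpha>)"
  using r
proof (induction rule: Well_order_underS_induct[where \<alpha> = \<alpha>])
  case (less \<alpha>)
  have super: "Ann_series B r \<gamma> \<subseteq> Ann_next B (Ann_series B r \<gamma>)" if "\<gamma> \<in> underS r \<alpha>" for \<gamma>
    using less that Ann_next_superset by blast
  have mono: "Ann_series B r \<beta> \<subseteq> Ann_series B r \<gamma>"
    if "\<beta> \<in> underS r \<gamma>" "\<gamma> \<in> underS r \<alpha>" for \<beta> \<gamma>
    using less that super[OF Well_order_underS_trans[OF r that]] by blast
  from r show ?case
  proof (cases rule: Ann_series_cases[where \<alpha> = \<alpha> and B = B])
    case zero
    then show ?thesis
      by (simp add: brace_ideal_zero)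
  next
    case (succ \<gamma>)
    have "Ann_next B (Ann_series B r \<beta>) \<subseteq> Ann_series B r \<alpha>" if \<beta>: "\<beta> \<in> underS r \<alpha>" for \<beta>
    proof (cases "\<beta> = \<gamma>")
      case False
      have "\<gamma> \<in> Field r"
        using succ(1) by (auto simp: underS_def Field_def)
      then have "\<beta> \<in> underS r \<gamma>"
        using False \<beta> succ mem_under_iff[OF r] by blast
      then show ?thesis
        using less succ(1,3) super by blast
    qed (use succ in simp)
    with succ less show ?thesis
      by (simp add: brace_ideal_Ann_next)
  next
    case limit
    have "brace_ideal B (\<Union> (Ann_series B r ` underS r \<alpha>))"
    proof (rule brace_ideal_Union_chain)
      fix I J assume "I \<in> Ann_series B r ` underS r \<alpha>" "J \<in> Ann_series B r ` underS r \<alpha>"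
      then obtain \<beta> \<gamma> where \<beta>\<gamma>: "\<beta> \<in> underS r \<alpha>" "\<gamma> \<in> underS r \<alpha>"
        "I = Ann_series B r \<beta>" "J = Ann_series B r \<gamma>"
        by blast
      moreover have "\<beta> \<in> Field r" "\<gamma> \<in> Field r"
        using \<beta>\<gamma> by (auto simp: underS_def Field_def)
      ultimately show "I \<subseteq> J \<or> J \<subseteq> I"
        using Well_order_underS_total[OF r] mono by blast
    qed (use less limit in auto)
    moreover have "Ann_next B (Ann_series B r \<beta>) \<subseteq> Ann_series B r \<alpha>" if \<beta>: "\<beta> \<in> underS r \<alpha>" for \<beta>
    proof -
      obtain \<gamma> where "\<gamma> \<in> underS r \<alpha>" "\<beta> \<in> underS r \<gamma>"
        using underS_limit_between[OF r \<beta> limit(2)[OF \<beta>]] .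
      then show ?thesis
        using less limit(3) by blast
    qed
    ultimately show ?thesis
      by (simp add: limit(3))
  qed
qed

lemma brace_ideal_Ann_series: "Well_order r \<Longrightarrow> brace_ideal B (Ann_series B r \<alpha>)"
  by (rule Ann_series_ideal_mono[THEN conjunct1])

lemma Ann_next_series_subset:
  "Well_order r \<Longrightarrow> \<beta> \<in> underS r \<alpha> \<Longrightarrow> Ann_next B (Ann_series B r \<beta>) \<subseteq> Ann_series B r \<alpha>"
  by (rule Ann_series_ideal_mono[THEN conjunct2, THEN bspec])

lemma Ann_series_mono:
  assumes "Well_order r" "\<beta> \<in> underS r \<alpha>"
  shows "Ann_series B r \<beta> \<subseteq> Ann_series B r \<alpha>"
  by (rule subset_trans[OF Ann_next_superset[OF brace_ideal_Ann_series[OF assms(1)]]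
        Ann_next_series_subset[OF assms]])

text \<open>The first term whose intersection with \<open>C\<close> is not contained in \<open>I\<close> would be a successor.
  Its elements in \<open>C\<close> are annihilating in \<open>C\<close> modulo the intersection of \<open>C\<close> with the preceding
  term, hence modulo \<open>I\<close>, and so they lie in \<open>Ann_next\<close> of \<open>I\<close>, which is \<open>I\<close>.\<close>

lemma Ann_series_subset_fixed:
  assumes r: "Well_order r" and C: "sub_skew_brace B C"
    and I: "brace_ideal (B\<lparr>carrier := C\<rparr>) I" "Ann_next (B\<lparr>carrier := C\<rparr>) I \<subseteq> I"
  shows "C \<inter> Ann_series B r \<alpha> \<subseteq> I"
  using r
proof (induction rule: Well_order_underS_induct[where \<alpha> = \<alpha>])
  case (less \<alpha>)
  interpret C: skew_brace "B\<lparr>carrier := C\<rparr>"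
    by (rule skew_brace_sub[OF C])
  from r show ?case
  proof (cases rule: Ann_series_cases[where \<alpha> = \<alpha> and B = B])
    case zero
    then show ?thesis
      using C.zero_in_brace_ideal[OF I(1)] by auto
  next
    case (succ \<beta>)
    show ?thesis
    proof
      fix c assume c: "c \<in> C \<inter> Ann_series B r \<alpha>"
      let ?A = "Ann_series B r \<beta>"
      have A: "subgroup ?A (add_monoid B)"
        using brace_ideal_add_subgroup[OF brace_ideal_Ann_series[OF r]] .
      have C_sub: "C \<subseteq> carrier B" "subgroup C (add_monoid B)"
        using C sub_skew_brace_subset by (auto simp: sub_skew_brace_def)
      \<comment> \<open>two elements of \<open>C\<close> in one coset of the \<open>\<beta>\<close>-th term differ by an element of
         \<open>C\<close>, hence by an element of \<open>I\<close>\<close>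
      have coset: "I +> u = I +> v" if uv: "?A +> u = ?A +> v" "u \<in> C" "v \<in> C" for u v
      proof -
        have uvB: "u \<in> carrier B" "v \<in> carrier B"
          using uv(2,3) C_sub(1) by auto
        obtain i where i: "i \<in> ?A" and u: "u = i \<oplus> v"
          using uv(1) unfolding coset_eq_iff[OF A uvB] by blast
        have "i \<in> carrier B"
          using i subgroup.subset[OF A] by auto
        then have "u \<oplus> \<ominus> v = i"
          unfolding u using uvB by (simp add: add.m_assoc add.r_inv)
        moreover have "u \<oplus> \<ominus> v \<in> C"
          using uv(2,3) subgroup.m_closed[OF C_sub(2)] subgroup.m_inv_closed[OF C_sub(2), folded a_inv_def]
          by simp
        ultimately have "i \<in> I"
          using i less(1)[OF succ(1)] by blast
        then show ?thesis
          using C.coset_eq_iff[OF C.brace_ideal_add_subgroup[OF I(1)], of u v] uv(2,3) u by auto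
      qed
      have "trivial_mod (B\<lparr>carrier := C\<rparr>) I c d" if d: "d \<in> C" for d
      proof -
        have c': "c \<in> C" "c \<in> Ann_next B ?A"
          using c succ(3) by auto
        then have "trivial_mod B ?A c d"
          using d C_sub(1) by (auto simp: mem_Ann_next_iff[OF brace_ideal_Ann_series[OF r]])
        moreover have "c \<otimes> d \<in> C" "d \<otimes> c \<in> C" "c \<oplus> d \<in> C" "d \<oplus> c \<in> C"
          using c' d C.m_closed C.add.m_closed by simp_all
        ultimately show ?thesis
          using coset[of "c \<otimes> d" "c \<oplus> d"] coset[of "d \<oplus> c" "c \<oplus> d"] coset[of "d \<otimes> c" "c \<oplus> d"]
          by (simp add: trivial_mod_def)
      qed
      then show "c \<in> I"
        using c I(2) C.mem_Ann_next_iff[OF I(1), of c] by auto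
    qed
  next
    case limit
    then show ?thesis
      using less by auto
  qed
qed

lemma Ann_series_constant_above:
  assumes r: "Well_order r" and fixed: "Ann_next B (Ann_series B r \<alpha>) \<subseteq> Ann_series B r \<alpha>"
    and \<beta>: "\<alpha> \<in> underS r \<beta>"
  shows "Ann_series B r \<beta> = Ann_series B r \<alpha>"
proof
  have upd: "B\<lparr>carrier := carrier B\<rparr> = B"
    by (cases B) simp
  have "carrier B \<inter> Ann_series B r \<beta> \<subseteq> Ann_series B r \<alpha>"
    using r sub_skew_brace_carrier
  proof (rule Ann_series_subset_fixed)
    show "brace_ideal (B\<lparr>carrier := carrier B\<rparr>) (Ann_series B r \<alpha>)"
      unfolding upd by (rule brace_ideal_Ann_series[OF r])
    show "Ann_next (B\<lparr>carrier := carrier B\<rparr>) (Ann_series B r \<alpha>) \<subseteq> Ann_series B r \<alpha>"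
      unfolding upd by (rule fixed)
  qed
  with brace_ideal_subset[OF brace_ideal_Ann_series[OF r, of \<beta>]]
  show "Ann_series B r \<beta> \<subseteq> Ann_series B r \<alpha>"
    by (simp only: Int_absorb1)
  show "Ann_series B r \<alpha> \<subseteq> Ann_series B r \<beta>"
    by (rule Ann_series_mono[OF r \<beta>])
qed

text \<open>If no term contained its successor, the choice of an element of
  \<open>Ann_next B (Ann_series B r \<alpha>) - Ann_series B r \<alpha>\<close> for every \<open>\<alpha>\<close> would be an injection of
  the power set of \<open>'a\<close> into \<open>'a\<close>, against Cantor's theorem.  The term at the least index of
  constancy is equal to any term that does contain its successor.\<close>

lemma hyper_Ann_props:
  shows "brace_ideal B (hyper_Ann B)" and "Ann_next B (hyper_Ann B) \<subseteq> hyper_Ann B"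
    and "\<exists>\<alpha>. hyper_Ann B = Ann_series B (card_of (UNIV :: 'a set set)) \<alpha>"
proof -
  define r where "r = card_of (UNIV :: 'a set set)"
  have r: "Well_order r"
    unfolding r_def by (rule card_of_Well_order)
  have field: "\<alpha> \<in> Field r" for \<alpha>
    unfolding r_def by (simp add: Field_card_of)
  let ?A = "Ann_series B r"
  have "\<exists>\<alpha>. Ann_next B (?A \<alpha>) \<subseteq> ?A \<alpha>"
  proof (rule ccontr)
    assume "\<not> ?thesis"
    then have "\<forall>\<alpha>. \<exists>x. x \<in> Ann_next B (?A \<alpha>) \<and> x \<notin> ?A \<alpha>"
      by blast
    then obtain f where f: "\<And>\<alpha>. f \<alpha> \<in> Ann_next B (?A \<alpha>)" "\<And>\<alpha>. f \<alpha> \<notin> ?A \<alpha>"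
      by metis
    have less: "f \<alpha> \<noteq> f \<beta>" if "\<alpha> \<in> underS r \<beta>" for \<alpha> \<beta>
      using subsetD[OF Ann_next_series_subset[OF r that] f(1)] f(2)[of \<beta>] by auto
    have "inj f"
    proof (rule injI)
      fix \<alpha> \<beta> assume "f \<alpha> = f \<beta>"
      then show "\<alpha> = \<beta>"
        using Well_order_underS_total[OF r field field, of \<alpha> \<beta>] less[of \<alpha> \<beta>] less[of \<beta> \<alpha>] by auto
    qed
    then have "range (inv_into UNIV f) = Pow UNIV"
      using inj_imp_surj_inv[of f] by simp
    then show False
      using Cantors_theorem[of "UNIV :: 'a set"] by blast
  qed
  then obtain \<alpha> where \<alpha>: "Ann_next B (?A \<alpha>) \<subseteq> ?A \<alpha>"
    by blast
  define S where "S = {\<alpha>. \<forall>\<beta>. (\<alpha>, \<beta>) \<in> r \<longrightarrow> ?A \<beta> = ?A \<alpha>}"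
  define \<mu> where "\<mu> = wo_rel.minim r S"
  have wo: "wo_rel r"
    using r by (simp add: wo_rel_def)
  have hyper: "hyper_Ann B = ?A \<mu>"
    by (simp add: hyper_Ann_def Let_def \<mu>_def S_def r_def)
  have "?A \<beta> = ?A \<alpha>" if "(\<alpha>, \<beta>) \<in> r" for \<beta>
    using Ann_series_constant_above[OF r \<alpha>, of \<beta>] that by (cases "\<beta> = \<alpha>") (simp_all add: underS_def)
  then have \<alpha>S: "\<alpha> \<in> S"
    by (simp add: S_def)
  then have "\<mu> \<in> S" "(\<mu>, \<alpha>) \<in> r"
    unfolding \<mu>_def using wo_rel.minim_in[OF wo, of S] wo_rel.minim_least[OF wo, of S \<alpha>] field
    by (simp_all add: subset_iff) blast
  then have "?A \<mu> = ?A \<alpha>"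
    by (simp add: S_def)
  with \<alpha> hyper brace_ideal_Ann_series[OF r]
  show "brace_ideal B (hyper_Ann B)" "Ann_next B (hyper_Ann B) \<subseteq> hyper_Ann B"
    by simp_all
  show "\<exists>\<alpha>. hyper_Ann B = Ann_series B (card_of (UNIV :: 'a set set)) \<alpha>"
    using hyper r_def by blast
qed

end

lemma underS_natLeq: "underS natLeq n = {..<n}" and under_natLeq: "under natLeq n = {..n}"
  by (auto simp: underS_def under_def natLeq_def)

lemma Ann_series_natLeq_0: "Ann_series B natLeq 0 = {\<zero>\<^bsub>B\<^esub>}"
  by (rule Ann_series_zero[OF natLeq_Well_order]) (simp add: underS_natLeq)

lemma Ann_series_natLeq_Suc: "Ann_series B natLeq (Suc n) = Ann_next B (Ann_series B natLeq n)"
  by (rule Ann_series_succ[OF natLeq_Well_order]) (auto simp: underS_natLeq under_natLeq)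

section \<open>Consequences of finite indices\<close>

text \<open>The key of \<open>b\<close> records the cosets of \<open>b\<close> modulo all the subgroups that property (S)
  attaches to the elements of \<open>Y\<close>, for both operations at once: the same two elements must have
  a controlled additive and a controlled multiplicative difference.\<close>

definition coset_key :: "('a, 'm) ring_scheme \<Rightarrow> 'a set \<Rightarrow> 'a \<Rightarrow> 'a \<Rightarrow> 'a set \<times> 'a set" where
  "coset_key B Y b = (\<lambda>y\<in>Y.
     ((Fix_r B y \<inter> centralizer (add_monoid B) y) +>\<^bsub>B\<^esub> b,
      (Fix_l B y \<inter> centralizer B y) #>\<^bsub>B\<^esub> b))"

context skew_brace
begin

lemma finite_range_coset_key:
  assumes S: "property_S B" and Y: "finite Y" "Y \<subseteq> carrier B"
  shows "finite (coset_key B Y ` carrier B)"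
proof (rule finite_subset)
  let ?P = "\<lambda>y. rcosets\<^bsub>add_monoid B\<^esub> (Fix_r B y \<inter> centralizer (add_monoid B) y)"
  let ?M = "\<lambda>y. rcosets (Fix_l B y \<inter> centralizer B y)"
  show "coset_key B Y ` carrier B \<subseteq> (\<Pi>\<^sub>E y\<in>Y. ?P y \<times> ?M y)"
    by (auto simp: coset_key_def RCOSETS_def a_r_coset_def)
  have "finite (?P y \<times> ?M y)" if "y \<in> Y" for y
    using that S Y by (auto simp: property_S_def element_property_s_def)
  then show "finite (\<Pi>\<^sub>E y\<in>Y. ?P y \<times> ?M y)"
    using Y(1) by (rule finite_PiE[rotated])
qed

lemma same_coset_key:
  assumes key: "coset_key B Y b = coset_key B Y c" and Y: "Y \<subseteq> carrier B"
    and b: "b \<in> carrier B" and c: "c \<in> carrier B"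
  shows "\<And>y. y \<in> Y \<Longrightarrow> b \<oplus> \<ominus> c \<in> Fix_r B y \<inter> centralizer (add_monoid B) y"
    and "\<And>y. y \<in> Y \<Longrightarrow> b \<otimes> inv c \<in> Fix_l B y \<inter> centralizer B y"
proof -
  fix y assume y: "y \<in> Y"
  let ?P = "Fix_r B y \<inter> centralizer (add_monoid B) y" and ?M = "Fix_l B y \<inter> centralizer B y"
  have yB: "y \<in> carrier B"
    using y Y by blast
  have P: "subgroup ?P (add_monoid B)" and M: "subgroup ?M B"
    using yB by (simp_all add: add.subgroups_Inter_pair subgroups_Inter_pair subgroup_Fix_r
        subgroup_Fix_l add.subgroup_centralizer subgroup_centralizer)
  from fun_cong[OF key, of y] y have eq: "?P +> b = ?P +> c" "?M #> b = ?M #> c"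
    by (simp_all add: coset_key_def)
  from eq(1) obtain l where "l \<in> ?P" "b = l \<oplus> c"
    using coset_eq_iff[OF P b c] by blast
  moreover from this have "l \<in> carrier B"
    using subgroup.subset[OF P] by auto
  ultimately show "b \<oplus> \<ominus> c \<in> ?P"
    using c by (simp add: add.m_assoc add.r_inv)
  have "b \<in> ?M #> c"
    using rcos_self[OF b M] eq(2) by simp
  then obtain k where "k \<in> ?M" "b = k \<otimes> c"
    by (auto simp: r_coset_def)
  moreover from this have "k \<in> carrier B"
    using subgroup.subset[OF M] by auto
  ultimately show "b \<otimes> inv c \<in> ?M"
    using c by (simp add: m_assoc)
qed

lemma coset_key_representatives:
  assumes "property_S B" "finite Y" "Y \<subseteq> carrier B"
  obtains T where "finite T" "T \<subseteq> carrier B"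
    "\<And>b. b \<in> carrier B \<Longrightarrow> \<exists>t\<in>T. coset_key B Y b = coset_key B Y t"
proof -
  obtain T where T: "T \<subseteq> carrier B" "finite T" "coset_key B Y ` carrier B = coset_key B Y ` T"
    using finite_subset_image[OF finite_range_coset_key[OF assms] order_refl] by blast
  moreover have "\<exists>t\<in>T. coset_key B Y b = coset_key B Y t" if "b \<in> carrier B" for b
    using imageI[OF that, of "coset_key B Y"] unfolding T(3) by auto
  ultimately show thesis
    using that by blast
qed

lemma finite_lam_orbit:
  assumes S: "property_S B" and x: "x \<in> carrier B"
  shows "finite ((\<lambda>b. lam b x) ` carrier B)"
proof -
  obtain T where T: "finite T" "T \<subseteq> carrier B"
    "\<And>b. b \<in> carrier B \<Longrightarrow> \<exists>t\<in>T. coset_key B {x} b = coset_key B {x} t"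
    using coset_key_representatives[OF S, of "{x}"] x by auto
  have "(\<lambda>b. lam b x) ` carrier B \<subseteq> (\<lambda>t. lam (inv t) x) ` T"
  proof (intro subsetI, elim imageE, clarify)
    fix b assume b: "b \<in> carrier B"
    obtain t where t: "t \<in> T" "coset_key B {x} (inv b) = coset_key B {x} t"
      using T(3)[of "inv b"] b by auto
    have tB: "t \<in> carrier B"
      using t T by auto
    \<comment> \<open>right cosets of the stabiliser of \<open>x\<close> correspond to the images of \<open>x\<close> under inverses\<close>
    have "inv b \<otimes> inv t \<in> Fix_l B x"
      using same_coset_key(2)[OF t(2), of x] x b tB by simp
    then have "lam (inv b \<otimes> inv t) x = x"
      using x b tB by (simp add: mem_Fix_l_iff mult_eq_add_lam[of "inv b \<otimes> inv t"])
    then have "lam (inv b) (lam (inv t) x) = x"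
      using x b tB by (simp add: lam_mult)
    then have "lam b x = lam (inv t) x"
      using x b tB lam_lam_inv[of b "lam (inv t) x"] by simp
    then show "lam b x \<in> (\<lambda>t. lam (inv t) x) ` T"
      using t by blast
  qed
  then show ?thesis
    using T(1) finite_subset by blast
qed

text \<open>\<open>Y\<close> consists of the images of a generating set \<open>X\<close> under the maps \<open>\<lambda>\<^sub>c\<close>, \<open>c \<in> C\<close>.
  Invariance under \<open>\<lambda>\<close> is what turns one operation into the other: \<open>a \<circ> b = a + \<lambda>\<^sub>a(b)\<close> stays
  in the additive span of \<open>Y\<close>, and conversely, for \<open>y \<in> Y\<close>, \<open>a + y = a \<circ> \<lambda>\<^sub>c(y)\<close> with \<open>c = a\<^sup>-\<^sup>1\<close>
  stays in the multiplicative one.\<close>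

lemma fg_brace_group_generators:
  assumes S: "property_S B" and C: "sub_skew_brace B C" and fg: "fg_brace (B\<lparr>carrier := C\<rparr>)"
  obtains Y where "finite Y" "Y \<subseteq> C" "C = generate (add_monoid B) Y" "C = generate B Y"
proof -
  from fg obtain X where X: "finite X" "X \<subseteq> C"
    and least: "\<And>D. sub_skew_brace B D \<Longrightarrow> X \<subseteq> D \<Longrightarrow> C \<subseteq> D"
    using fg_brace_sub_iff[OF C] by metis
  have CB: "C \<subseteq> carrier B" and C_add: "subgroup C (add_monoid B)" and C_mult: "subgroup C B"
    using C sub_skew_brace_subset by (auto simp: sub_skew_brace_def)
  have inC: "a \<in> carrier B" if "a \<in> C" for a
    using that CB by auto
  have C_neg: "\<ominus> a \<in> C" if "a \<in> C" for a
    using subgroup.m_inv_closed[OF C_add that] by (simp add: a_inv_def)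
  have C_inv: "inv a \<in> C" if "a \<in> C" for a
    using subgroup.m_inv_closed[OF C_mult that] .
  have C_lam: "lam c a \<in> C" if "c \<in> C" "a \<in> C" for a c
    using subgroup.m_closed[OF C_add C_neg[OF that(1)] subgroup.m_closed[OF C_mult that]]
    by (simp add: brace_lambda_def)
  define Y where "Y = (\<Union>x\<in>X. (\<lambda>c. lam c x) ` C)"
  have Y_sub: "Y \<subseteq> C"
    unfolding Y_def using X(2) C_lam by blast
  have Y_lam: "lam c y \<in> Y" if c: "c \<in> C" and y: "y \<in> Y" for c y
  proof -
    from y obtain d x where dx: "d \<in> C" "x \<in> X" "y = lam d x"
      unfolding Y_def by blast
    then have "lam c y = lam (c \<otimes> d) x"
      using c X(2) inC by (simp add: lam_mult subset_iff)
    then show ?thesis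
      unfolding Y_def using dx(2) subgroup.m_closed[OF C_mult c dx(1)] by blast
  qed
  have "finite ((\<lambda>c. lam c x) ` C)" if "x \<in> X" for x
    using finite_subset[OF image_mono[OF CB] finite_lam_orbit[OF S]] that X(2) CB by blast
  then have Y_fin: "finite Y"
    unfolding Y_def using X(1) by blast
  have XY: "X \<subseteq> Y"
  proof
    fix x assume x: "x \<in> X"
    then have "x = lam \<zero> x"
      using X(2) inC by auto
    then show "x \<in> Y"
      unfolding Y_def using x subgroup.one_closed[OF C_mult] by auto
  qed
  have YB: "Y \<subseteq> carrier B"
    using Y_sub CB by blast
  let ?A = "generate (add_monoid B) Y" and ?M = "generate B Y"
  have A: "subgroup ?A (add_monoid B)"
    using add.generate_is_subgroup YB by simp
  have M: "subgroup ?M B"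
    using generate_is_subgroup YB by simp
  have AC: "?A \<subseteq> C" and MC: "?M \<subseteq> C"
    using add.generate_subgroup_incl[OF Y_sub C_add] generate_subgroup_incl[OF Y_sub C_mult] by auto
  have YA: "Y \<subseteq> ?A" and YM: "Y \<subseteq> ?M"
    by (auto intro: generate.incl)
  have A_neg: "\<ominus> a \<in> ?A" if "a \<in> ?A" for a
    using subgroup.m_inv_closed[OF A that] by (simp add: a_inv_def)
  have A_lam: "lam c a \<in> ?A" if c: "c \<in> C" and a: "a \<in> ?A" for c a
  proof -
    have "subgroup {a \<in> carrier B. lam c a \<in> ?A} (add_monoid B)"
    proof (rule add.subgroupI)
      have "\<zero> \<in> {a \<in> carrier B. lam c a \<in> ?A}"
        using subgroup.one_closed[OF A] inC[OF c] by simp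
      then show "{a \<in> carrier B. lam c a \<in> ?A} \<noteq> {}"
        by blast
      show "\<ominus> a \<in> {a \<in> carrier B. lam c a \<in> ?A}" if "a \<in> {a \<in> carrier B. lam c a \<in> ?A}" for a
        using that A_neg inC[OF c] by (simp add: lam_neg)
      show "a \<oplus> b \<in> {a \<in> carrier B. lam c a \<in> ?A}"
        if "a \<in> {a \<in> carrier B. lam c a \<in> ?A}" "b \<in> {a \<in> carrier B. lam c a \<in> ?A}" for a b
        using that subgroup.m_closed[OF A, of "lam c a" "lam c b"] inC[OF c] by (simp add: lam_add)
    qed auto
    moreover have "Y \<subseteq> {a \<in> carrier B. lam c a \<in> ?A}"
      using Y_lam[OF c] YA YB by blast
    ultimately have "?A \<subseteq> {a \<in> carrier B. lam c a \<in> ?A}"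
      by (intro add.generate_subgroup_incl)
    with a show ?thesis
      by blast
  qed
  \<comment> \<open>as \<open>Y\<close> is invariant under \<open>\<lambda>\<close>, its additive span is also closed under \<open>\<circ>\<close>\<close>
  have "subgroup ?A B"
  proof (rule subgroupI)
    show "?A \<subseteq> carrier B"
      using AC CB by blast
    show "?A \<noteq> {}"
      using subgroup.one_closed[OF A] by auto
    show "inv a \<in> ?A" if a: "a \<in> ?A" for a
    proof -
      have aC: "a \<in> C"
        using a AC by blast
      show ?thesis
        using A_neg[OF A_lam[OF C_inv[OF aC] a]] inv_eq_neg_lam[OF inC[OF aC]] by simp
    qed
    show "a \<otimes> b \<in> ?A" if ab: "a \<in> ?A" "b \<in> ?A" for a b
    proof -
      have "a \<in> C" "b \<in> C"
        using ab AC by auto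
      then show ?thesis
        using subgroup.m_closed[OF A ab(1) A_lam[OF _ ab(2), of a]] inC by (simp add: mult_eq_add_lam)
    qed
  qed
  then have "sub_skew_brace B ?A"
    using A by (simp add: sub_skew_brace_def)
  then have CA: "C = ?A"
    using least[of ?A] XY YA AC by blast
  \<comment> \<open>the elements by which \<open>?M\<close> can be translated additively contain \<open>Y\<close>, hence \<open>C\<close>\<close>
  let ?P = "{b \<in> carrier B. \<forall>a\<in>?M. a \<oplus> b \<in> ?M \<and> a \<oplus> \<ominus> b \<in> ?M}"
  have MB: "a \<in> carrier B" if "a \<in> ?M" for a
    using that MC CB by blast
  have "subgroup ?P (add_monoid B)"
  proof (rule add.subgroupI)
    have "\<zero> \<in> ?P"
      using MB by simp
    then show "?P \<noteq> {}"
      by blast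
    show "\<ominus> b \<in> ?P" if "b \<in> ?P" for b
      using that by simp
    show "b \<oplus> b' \<in> ?P" if b: "b \<in> ?P" "b' \<in> ?P" for b b'
    proof -
      have "a \<oplus> (b \<oplus> b') \<in> ?M" "a \<oplus> \<ominus> (b \<oplus> b') \<in> ?M" if a: "a \<in> ?M" for a
      proof -
        have "(a \<oplus> b) \<oplus> b' \<in> ?M" "(a \<oplus> \<ominus> b') \<oplus> \<ominus> b \<in> ?M"
          using a b by simp_all
        then show "a \<oplus> (b \<oplus> b') \<in> ?M" "a \<oplus> \<ominus> (b \<oplus> b') \<in> ?M"
          using b MB[OF a] by (simp_all add: add.inv_mult_group add.m_assoc)
      qed
      with b show ?thesis
        by simp
    qed
  qed auto
  moreover have "Y \<subseteq> ?P"
  proof (intro subsetI CollectI conjI ballI)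
    fix y assume y: "y \<in> Y"
    then show yB: "y \<in> carrier B"
      using YB by blast
    fix a assume a: "a \<in> ?M"
    have aC: "a \<in> C" and aB: "a \<in> carrier B"
      using a MC CB by auto
    have y': "lam (inv a) y \<in> Y"
      using Y_lam[OF C_inv[OF aC] y] .
    show "a \<oplus> y \<in> ?M"
      using subgroup.m_closed[OF M a subsetD[OF YM y']] aB yB by (simp add: add_eq_mult_lam)
    \<comment> \<open>the multiplicative inverse of the negative of an element of \<open>Y\<close> is again in \<open>Y\<close>\<close>
    let ?n = "\<ominus> lam (inv a) y"
    have nC: "?n \<in> C" and nB: "?n \<in> carrier B"
      using y' Y_sub C_neg CB by auto
    have "inv ?n = lam (inv ?n) (lam (inv a) y)"
      using inv_eq_neg_lam[OF nB] nB aB yB by (simp add: lam_neg)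
    then have "inv ?n \<in> ?M"
      using Y_lam[OF C_inv[OF nC] y'] YM by auto
    then have "?n \<in> ?M"
      using subgroup.m_inv_closed[OF M, of "inv ?n"] nB by simp
    then show "a \<oplus> \<ominus> y \<in> ?M"
      using subgroup.m_closed[OF M a] aB yB by (simp add: add_eq_mult_lam lam_neg)
  qed
  ultimately have "?A \<subseteq> ?P"
    by (intro add.generate_subgroup_incl)
  have "C \<subseteq> ?M"
  proof
    fix c assume c: "c \<in> C"
    then have "c \<in> ?P"
      using \<open>?A \<subseteq> ?P\<close> CA by blast
    moreover have "\<zero> \<in> ?M"
      using subgroup.one_closed[OF M] by simp
    ultimately have "\<zero> \<oplus> c \<in> ?M"
      by blast
    then show "c \<in> ?M"
      using inC[OF c] by simp
  qed
  then have "C = ?M"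
    using MC by blast
  with that[OF Y_fin Y_sub CA] show thesis
    by blast
qed

text \<open>The relations \<open>l \<in> Fix_r y\<close> and \<open>y \<in> Fix_l l\<close> are the same, but for fixed \<open>l\<close> the
  latter describes a subgroup of \<open>(B,\<circ>)\<close> in \<open>y\<close>; likewise \<open>k \<in> Fix_l y\<close> describes an additive
  subgroup in \<open>y\<close>.  Therefore each of the conclusions needs generation in its own one of the two
  groups.\<close>

lemma Fix_r_centralizer_generated:
  assumes Y: "Y \<subseteq> carrier B" and l: "\<And>y. y \<in> Y \<Longrightarrow> l \<in> Fix_r B y \<inter> centralizer (add_monoid B) y"
    and lB: "l \<in> carrier B"
  shows "z \<in> generate (add_monoid B) Y \<Longrightarrow> l \<oplus> z = z \<oplus> l"
    and "z \<in> generate B Y \<Longrightarrow> z \<otimes> l = z \<oplus> l"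
proof -
  have "Y \<subseteq> centralizer (add_monoid B) l"
    using l Y by (auto simp: centralizer_def)
  then have "generate (add_monoid B) Y \<subseteq> centralizer (add_monoid B) l"
    using add.generate_subgroup_incl add.subgroup_centralizer lB by simp
  then show "z \<in> generate (add_monoid B) Y \<Longrightarrow> l \<oplus> z = z \<oplus> l"
    by (auto simp: centralizer_def)
  have "y \<in> Fix_l B l" if "y \<in> Y" for y
    using l[OF that] Y lB that by (auto simp: mem_Fix_l_iff mem_Fix_r_iff)
  then have "generate B Y \<subseteq> Fix_l B l"
    using generate_subgroup_incl[of Y "Fix_l B l"] subgroup_Fix_l[OF lB] by blast
  then show "z \<in> generate B Y \<Longrightarrow> z \<otimes> l = z \<oplus> l"
    using mem_Fix_l_iff[OF lB] by blast
qed

lemma Fix_l_centralizer_generated: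
  assumes Y: "Y \<subseteq> carrier B" and k: "\<And>y. y \<in> Y \<Longrightarrow> k \<in> Fix_l B y \<inter> centralizer B y"
    and kB: "k \<in> carrier B"
  shows "z \<in> generate B Y \<Longrightarrow> k \<otimes> z = z \<otimes> k"
    and "z \<in> generate (add_monoid B) Y \<Longrightarrow> k \<otimes> z = k \<oplus> z"
proof -
  have "Y \<subseteq> centralizer B k"
    using k Y by (auto simp: centralizer_def)
  then have "generate B Y \<subseteq> centralizer B k"
    using generate_subgroup_incl subgroup_centralizer kB by simp
  then show "z \<in> generate B Y \<Longrightarrow> k \<otimes> z = z \<otimes> k"
    by (auto simp: centralizer_def)
  have "y \<in> Fix_r B k" if "y \<in> Y" for y
    using k[OF that] Y kB that by (auto simp: mem_Fix_l_iff mem_Fix_r_iff)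
  then have "generate (add_monoid B) Y \<subseteq> Fix_r B k"
    using add.generate_subgroup_incl[of Y "Fix_r B k"] subgroup_Fix_r[OF kB] by blast
  then show "z \<in> generate (add_monoid B) Y \<Longrightarrow> k \<otimes> z = k \<oplus> z"
    using mem_Fix_r_iff[OF kB] by blast
qed

end

section \<open>The two implications\<close>

context skew_brace
begin

lemma Ann_series_natLeq_mono:
  assumes "m \<le> n"
  shows "Ann_series B natLeq m \<subseteq> Ann_series B natLeq n"
proof (cases "m = n")
  case False
  with assms have "m \<in> underS natLeq n"
    by (simp add: underS_natLeq)
  then show ?thesis
    by (rule Ann_series_mono[OF natLeq_Well_order])
qed simp

text \<open>Elements \<open>f n \<in> Ann\<^sub>n\<^sub>+\<^sub>1(C) - Ann\<^sub>n(C)\<close> for all \<open>n\<close> would include two with equal keys, whose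
  difference lies in \<open>Ann(C)\<close>; this would put the later one into the preceding term.  So the
  series of \<open>C\<close> stops at a finite stage, where it has absorbed all of \<open>C\<close>.\<close>

lemma ann_nilpotent_if_hyper_Ann:
  assumes S: "property_S B" and hyper: "carrier B = hyper_Ann B"
    and C: "sub_skew_brace B C" and fg: "fg_brace (B\<lparr>carrier := C\<rparr>)"
  shows "ann_nilpotent (B\<lparr>carrier := C\<rparr>)"
proof -
  interpret C: skew_brace "B\<lparr>carrier := C\<rparr>"
    by (rule skew_brace_sub[OF C])
  let ?A = "Ann_series (B\<lparr>carrier := C\<rparr>) natLeq"
  have CB: "C \<subseteq> carrier B" and C_add: "subgroup C (add_monoid B)"
    using C sub_skew_brace_subset by (auto simp: sub_skew_brace_def)
  have A_ideal: "brace_ideal (B\<lparr>carrier := C\<rparr>) (?A n)" for n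
    by (rule C.brace_ideal_Ann_series[OF natLeq_Well_order])
  have A_sub: "?A n \<subseteq> C" for n
    using C.brace_ideal_subset[OF A_ideal] by simp
  obtain Y where Y: "finite Y" "Y \<subseteq> C" "C = generate (add_monoid B) Y" "C = generate B Y"
    using fg_brace_group_generators[OF S C fg] .
  have YB: "Y \<subseteq> carrier B"
    using Y(2) CB by blast
  have "\<exists>n. ?A (Suc n) \<subseteq> ?A n"
  proof (rule ccontr)
    assume "\<not> ?thesis"
    then have "\<forall>n. \<exists>c. c \<in> ?A (Suc n) \<and> c \<notin> ?A n"
      by blast
    then obtain f where f: "\<And>n. f n \<in> ?A (Suc n)" "\<And>n. f n \<notin> ?A n"
      by metis
    have fC: "f n \<in> C" for n
      using f(1) A_sub by blast
    have "range (\<lambda>n. coset_key B Y (f n)) \<subseteq> coset_key B Y ` carrier B"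
      using fC CB by blast
    then have "finite (range (\<lambda>n. coset_key B Y (f n)))"
      using finite_range_coset_key[OF S Y(1) YB] finite_subset by blast
    then have "\<not> inj (\<lambda>n. coset_key B Y (f n))"
      using finite_imageD by blast
    then obtain m n where mn: "m < n" "coset_key B Y (f n) = coset_key B Y (f m)"
      unfolding inj_def by (metis linorder_neqE_nat)
    let ?b = "f n" and ?c = "f m"
    have bB: "?b \<in> carrier B" and cB: "?c \<in> carrier B"
      using fC CB by auto
    define k where "k = ?b \<otimes> inv ?c"
    have kB: "k \<in> carrier B"
      using bB cB by (simp add: k_def)
    have k: "k \<otimes> z = z \<otimes> k" "k \<otimes> z = k \<oplus> z" if "z \<in> C" for z
      using Fix_l_centralizer_generated[OF YB same_coset_key(2)[OF mn(2) YB bB cB, folded k_def] kB]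
        that Y(3,4) by blast+
    \<comment> \<open>the additive and the multiplicative difference of \<open>f n\<close> and \<open>f m\<close> agree\<close>
    have b_eq: "?b = k \<oplus> ?c"
      using k(2)[OF fC[of m]] bB cB by (simp add: k_def m_assoc)
    then have k_eq: "?b \<oplus> \<ominus> ?c = k"
      using kB cB by (simp add: add.m_assoc add.r_inv)
    have k': "k \<oplus> z = z \<oplus> k" if "z \<in> C" for z
      using Fix_r_centralizer_generated(1)[OF YB same_coset_key(1)[OF mn(2) YB bB cB, unfolded k_eq] kB]
        that Y(3) by blast
    have "k \<in> C"
      using subgroup.m_closed[OF C_add fC[of n] subgroup.m_inv_closed[OF C_add fC[of m]]] k_eq
      by (simp add: a_inv_def)
    then have "k \<in> ?A (Suc 0)"
      using k k' by (simp add: Ann_series_natLeq_Suc C.mem_Ann_next_iff[OF A_ideal] trivial_mod_def)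
    then have kA: "k \<in> ?A n"
      using C.Ann_series_natLeq_mono[of "Suc 0" n] mn(1) by auto
    have cA: "?c \<in> ?A n"
      using C.Ann_series_natLeq_mono[of "Suc m" n] mn(1) f(1)[of m] by auto
    have "?b \<in> ?A n"
      using subgroup.m_closed[OF C.brace_ideal_add_subgroup[OF A_ideal] kA cA] b_eq by simp
    with f(2) show False
      by blast
  qed
  then obtain n where n: "?A (Suc n) \<subseteq> ?A n"
    by blast
  obtain \<alpha> where \<alpha>: "hyper_Ann B = Ann_series B (card_of (UNIV :: 'a set set)) \<alpha>"
    using hyper_Ann_props(3) by blast
  have "C \<inter> Ann_series B (card_of (UNIV :: 'a set set)) \<alpha> \<subseteq> ?A n"
    using card_of_Well_order C A_ideal n[unfolded Ann_series_natLeq_Suc]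
    by (rule Ann_series_subset_fixed)
  then have "C = ?A n"
    using A_sub[of n] CB \<alpha> hyper by blast
  then show ?thesis
    unfolding ann_nilpotent_def by auto
qed

text \<open>The sub-skew brace \<open>F\<close> must contain both generators of \<open>N\<close> and representatives of the
  finitely many keys: the former make \<open>N\<close> a subset of \<open>F\<close>, the latter extend what holds for
  \<open>F\<close> to all of \<open>B\<close>.\<close>

lemma hyper_Ann_if_locally_ann_nilpotent:
  assumes S: "property_S B" and good: "good_brace B" and loc: "locally_ann_nilpotent B"
  shows "carrier B = hyper_Ann B"
proof (rule ccontr)
  assume neq: "carrier B \<noteq> hyper_Ann B"
  define H where "H = hyper_Ann B"
  have H: "brace_ideal B H" "Ann_next B H \<subseteq> H"
    using hyper_Ann_props(1,2) by (simp_all add: H_def)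
  have HB: "H \<subseteq> carrier B"
    by (rule brace_ideal_subset[OF H(1)])
  with neq obtain x where x: "x \<in> carrier B" "x \<notin> H"
    by (auto simp: H_def)
  define N where "N = brace_ideal B hull {x}"
  have fgN: "fg_ideal B N"
    unfolding N_def using x by (intro fg_ideal_hull) auto
  then have N: "brace_ideal B N"
    by (simp add: fg_ideal_def)
  have xN: "x \<in> N"
    unfolding N_def by (rule hull_inc) simp
  have NB: "N \<subseteq> carrier B"
    by (rule brace_ideal_subset[OF N])
  have "fg_brace (B\<lparr>carrier := N\<rparr>)"
    using good fgN NB by (simp add: good_brace_def good_ideal_def)
  then obtain Y where Y: "finite Y" "Y \<subseteq> N" "N = generate (add_monoid B) Y" "N = generate B Y"
    using fg_brace_group_generators[OF S brace_ideal_sub_skew_brace[OF N]] by blast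
  have YB: "Y \<subseteq> carrier B"
    using Y(2) NB by blast
  obtain T where T: "finite T" "T \<subseteq> carrier B"
    "\<And>b. b \<in> carrier B \<Longrightarrow> \<exists>t\<in>T. coset_key B Y b = coset_key B Y t"
    using coset_key_representatives[OF S Y(1) YB] by blast
  obtain F where F: "sub_skew_brace B F" "Y \<union> T \<subseteq> F" "fg_brace (B\<lparr>carrier := F\<rparr>)"
    using obtain_fg_sub_skew_brace[of "Y \<union> T"] Y(1) T(1,2) YB by blast
  interpret F: skew_brace "B\<lparr>carrier := F\<rparr>"
    by (rule skew_brace_sub[OF F(1)])
  have FB: "F \<subseteq> carrier B"
    by (rule sub_skew_brace_subset[OF F(1)])
  have NF: "N \<subseteq> F"
    using generate_subgroup_incl[of Y F] F(1,2) Y(4) by (simp add: sub_skew_brace_def)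
  let ?A = "Ann_series (B\<lparr>carrier := F\<rparr>) natLeq"
  have A_ideal: "brace_ideal (B\<lparr>carrier := F\<rparr>) (?A n)" for n
    by (rule F.brace_ideal_Ann_series[OF natLeq_Well_order])
  have "ann_nilpotent (B\<lparr>carrier := F\<rparr>)"
    using loc F by (simp add: locally_ann_nilpotent_def)
  then obtain n where n: "F = ?A n"
    by (auto simp: ann_nilpotent_def)
  define i where "i = (LEAST i. \<not> N \<inter> ?A i \<subseteq> H)"
  have "\<not> N \<inter> ?A n \<subseteq> H"
    using xN NF x(2) n by blast
  then have i: "\<not> N \<inter> ?A i \<subseteq> H"
    unfolding i_def by (rule LeastI)
  have least: "N \<inter> ?A j \<subseteq> H" if "j < i" for j
    using not_less_Least[of j "\<lambda>i. \<not> N \<inter> ?A i \<subseteq> H"] that unfolding i_def by blast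
  have "i \<noteq> 0"
  proof
    assume "i = 0"
    then have "?A i = {\<zero>}"
      by (simp add: Ann_series_natLeq_0)
    with i show False
      using zero_in_brace_ideal[OF H(1)] by auto
  qed
  then obtain j where j: "i = Suc j"
    by (cases i) auto
  from i obtain z where z: "z \<in> N" "z \<in> ?A (Suc j)" "z \<notin> H"
    unfolding j by blast
  have zB: "z \<in> carrier B" and zF: "z \<in> F"
    using z(1) NB NF by auto
  have zN: "z \<in> Ann_next B N"
    using Ann_next_superset[OF N] z(1) by blast
  \<comment> \<open>\<open>z\<close> is annihilating for \<open>F\<close> modulo \<open>?A j\<close> by choice and modulo \<open>N\<close> because it lies in
     \<open>N\<close>; modulo both, it is so modulo their intersection, which is part of \<open>H\<close>\<close>
  have coset: "H +> u = H +> v"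
    if uv: "?A j +> u = ?A j +> v" "N +> u = N +> v" and F: "u \<in> F" "v \<in> F" for u v
  proof -
    have uvB: "u \<in> carrier B" "v \<in> carrier B"
      using F FB by auto
    obtain a where a: "a \<in> ?A j" "u = a \<oplus> v"
      using F.coset_eq_iff[OF F.brace_ideal_add_subgroup[OF A_ideal], of u v j] uv(1) F by auto
    obtain a' where a': "a' \<in> N" "u = a' \<oplus> v"
      using coset_eq_iff[OF brace_ideal_add_subgroup[OF N] uvB] uv(2) by blast
    have "a \<in> carrier B" "a' \<in> carrier B"
      using a(1) a'(1) F.brace_ideal_subset[OF A_ideal, of j] FB NB by auto
    then have "a = a'"
      using a(2) a'(2) add.right_cancel[of v a a'] uvB(2) by simp
    then have "a \<in> H"
      using a(1) a'(1) least[of j] j by blast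
    then show ?thesis
      using coset_eq_iff[OF brace_ideal_add_subgroup[OF H(1)] uvB] a(2) by blast
  qed
  have z_triv: "trivial_mod B H z t" if t: "t \<in> F" for t
  proof -
    have 1: "trivial_mod B (?A j) z t"
      using z(2) t F.mem_Ann_next_iff[OF A_ideal, of z j] by (simp add: Ann_series_natLeq_Suc)
    have 2: "trivial_mod B N z t"
      using zN t FB by (auto simp: mem_Ann_next_iff[OF N])
    have "z \<otimes> t \<in> F" "t \<otimes> z \<in> F" "z \<oplus> t \<in> F" "t \<oplus> z \<in> F"
      using zF t F.m_closed F.add.m_closed by simp_all
    with 1 2 show ?thesis
      using coset[of "z \<otimes> t" "z \<oplus> t"] coset[of "t \<oplus> z" "z \<oplus> t"] coset[of "t \<otimes> z" "z \<oplus> t"]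
      by (simp add: trivial_mod_def)
  qed
  have "trivial_mod B H z b" if b: "b \<in> carrier B" for b
  proof -
    obtain t where t: "t \<in> T" "coset_key B Y b = coset_key B Y t"
      using T(3)[OF b] by blast
    have tB: "t \<in> carrier B" and tF: "t \<in> F"
      using t(1) T(2) F(2) by auto
    define l where "l = b \<oplus> \<ominus> t"
    define k where "k = b \<otimes> inv t"
    have lB: "l \<in> carrier B" and kB: "k \<in> carrier B"
      and bl: "b = l \<oplus> t" and bk: "b = k \<otimes> t"
      using b tB by (simp_all add: l_def k_def add.m_assoc m_assoc)
    have lz: "l \<oplus> z = z \<oplus> l" "z \<otimes> l = z \<oplus> l"
      using Fix_r_centralizer_generated[OF YB same_coset_key(1)[OF t(2) YB b tB, folded l_def] lB]
        z(1) Y(3,4) by blast+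
    have kz: "k \<otimes> z = z \<otimes> k"
      using Fix_l_centralizer_generated(1)[OF YB same_coset_key(2)[OF t(2) YB b tB, folded k_def] kB]
        z(1) Y(4) by blast
    have zt: "H +> (z \<otimes> t) = H +> (z \<oplus> t)" "H +> (t \<oplus> z) = H +> (z \<oplus> t)"
      "H +> (t \<otimes> z) = H +> (z \<oplus> t)"
      using z_triv[OF tF] by (simp_all add: trivial_mod_def)
    \<comment> \<open>\<open>l\<close> and \<open>k\<close> can be moved past \<open>z\<close>, which leaves the known congruences between \<open>z\<close> and \<open>t\<close>\<close>
    have add: "z \<oplus> b = l \<oplus> (z \<oplus> t)"
      unfolding bl using zB lB tB lz(1) by (metis add.m_assoc)
    have "lam z l = l"
      using lz(2) zB lB by (intro lam_eqI)
    then have "z \<otimes> b = z \<oplus> (l \<oplus> lam z t)"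
      unfolding bl using zB lB tB by (simp add: mult_eq_add_lam lam_add)
    also have "\<dots> = l \<oplus> (z \<oplus> lam z t)"
      using zB lB tB lz(1) by (metis add.m_assoc lam_closed)
    finally have mult: "z \<otimes> b = l \<oplus> (z \<otimes> t)"
      using zB tB by (simp add: mult_eq_add_lam)
    have mult': "z \<otimes> b = k \<otimes> (z \<otimes> t)"
      unfolding bk using zB kB tB kz by (metis m_assoc)
    have 1: "H +> (z \<otimes> b) = H +> (z \<oplus> b)"
      unfolding add mult using zt(1) lB zB tB by (intro coset_add_cong[OF H(1) refl]) simp_all
    have "b \<oplus> z = l \<oplus> (t \<oplus> z)"
      unfolding bl using lB tB zB by (rule add.m_assoc)
    then have 2: "H +> (b \<oplus> z) = H +> (z \<oplus> b)"
      unfolding add using zt(2) lB zB tB by (metis coset_add_cong[OF H(1) refl] add.m_closed)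
    have "b \<otimes> z = k \<otimes> (t \<otimes> z)"
      unfolding bk using kB tB zB by (rule m_assoc)
    then have "H +> (b \<otimes> z) = H +> (z \<otimes> b)"
      unfolding mult' using zt(1,3) kB zB tB by (metis coset_mult_cong[OF H(1) refl] m_closed)
    with 1 2 show ?thesis
      by (simp add: trivial_mod_def)
  qed
  then have "z \<in> Ann_next B H"
    using zB by (simp add: mem_Ann_next_iff[OF H(1)])
  with H(2) z(3) show False
    by blast
qed

end

theorem corollary3p35:
  fixes B :: "('a, 'm) ring_scheme"
  assumes "skew_brace B" and "property_S B" and "good_brace B"
  shows "locally_ann_nilpotent B \<longleftrightarrow> carrier B = hyper_Ann B"
proof -
  interpret skew_brace B
    by fact
  show ?thesis
  proof
    assume "locally_ann_nilpotent B"
    with assms(2,3) show "carrier B = hyper_Ann B"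
      by (rule hyper_Ann_if_locally_ann_nilpotent)
  next
    assume "carrier B = hyper_Ann B"
    then show "locally_ann_nilpotent B"
      unfolding locally_ann_nilpotent_def using ann_nilpotent_if_hyper_Ann[OF assms(2)] by simp
  qed
qed

end
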